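(* For every $k\ge1$: $\rho_k(t)\le\rho_{k-1}(t)$ for every $t\ge0$, with strict inequality whenever $\rho_{k-1}(t)>0$. Furthermore, $\sigma_k\ge\sigma_{k-1}+1$.
   Context: Model: vertex set $[n]$. For each unordered pair of distinct vertices, edges arrive at the points of a Poisson process of rate $1/n$ on $(0,\infty)$, independently over pairs. $G_1(t)$ is the multigraph of edges arrived by time $t$; recursively, $F_k(t)$ is the subgraph of $G_k(t)$ of those edges which at their arrival time $s\le t$ joined two different components of $G_k(s)$, and $G_{k+1}(t):=G_k(t)\setminus F_k(t)$. $C_1(G)$ is the number of vertices in the largest component of $G$. For $k\ge1$, $\rho_k:[0,\infty)\to[0,1]$ is the continuous increasing function with $C_1(G_k(t))/n\to\rho_k(t)$ in probability uniformly in $t$, and $\sigma_k>0$ is the threshold such that $\rho_k(t)=0$ for $t\le\sigma_k$ and $\rho_k(t)>0$ for $t>\sigma_k$ (existence of both is a result of the same paper). Conventions: $\rho_0(t):=1$ for all $t\ge0$ and $\sigma_0:=0$. *)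

theory Defs
  imports "HOL-Probability.Probability" "HOL-Library.Nat_Bijection"
begin

type_synonym edge = "nat \<times> nat \<times> nat"   (* (u, v, j): j-th arrival on pair {u,v}, u < v *)
type_synonym sample = "edge \<Rightarrow> real"

text \<open>Underlying probability space: i.i.d. Exp(1) variables indexed by (u,v,j).
  For the graph on vertex set {0..<n} the inter-arrival times on the pair {u,v}
  are n times these, i.e. Exp(1/n): a Poisson process of rate 1/n.\<close>
definition Omega :: "sample measure" where
  "Omega = PiM UNIV (\<lambda>_. density lborel (exponential_density 1))"

definition arrival :: "nat \<Rightarrow> sample \<Rightarrow> edge \<Rightarrow> real" where
  "arrival n \<omega> x = real n * (\<Sum>i\<le>snd (snd x). \<omega> (fst x, fst (snd x), i))"

text \<open>Edges of the multigraph G_1(t) on vertex set {0..<n}.\<close>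
definition edges_upto :: "nat \<Rightarrow> sample \<Rightarrow> real \<Rightarrow> edge set" where
  "edges_upto n \<omega> t = {x. fst x < fst (snd x) \<and> fst (snd x) < n \<and> arrival n \<omega> x \<le> t}"

text \<open>Graph relation (symmetric) of those labelled edges whose label is at least k.\<close>
definition level_rel :: "(edge \<times> nat) list \<Rightarrow> nat \<Rightarrow> (nat \<times> nat) set" where
  "level_rel L k = {(a, b). \<exists>x l. (x, l) \<in> set L \<and> k \<le> l \<and>
       ((a, b) = (fst x, fst (snd x)) \<or> (b, a) = (fst x, fst (snd x)))}"

text \<open>Level of a new edge given the (labelled) earlier edges: the edge lies in F_k
  for the least k \<ge> 1 such that its endpoints are in different components of
  G_k just before its arrival (G_k = earlier edges of level \<ge> k).\<close>
definition new_level :: "(edge \<times> nat) list \<Rightarrow> edge \<Rightarrow> nat" where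
  "new_level L x = (LEAST k. 1 \<le> k \<and> (fst x, fst (snd x)) \<notin> (level_rel L k)\<^sup>*)"

definition add_edge :: "(edge \<times> nat) list \<Rightarrow> edge \<Rightarrow> (edge \<times> nat) list" where
  "add_edge L x = L @ [(x, new_level L x)]"

text \<open>Injective coding of edges as natural numbers (only used to list a finite edge set).\<close>
definition edge_code :: "edge \<Rightarrow> nat" where
  "edge_code x = prod_encode (fst x, prod_encode (snd x))"

definition edge_decode :: "nat \<Rightarrow> edge" where
  "edge_decode m = (fst (prod_decode m), prod_decode (snd (prod_decode m)))"

text \<open>All edges arrived by time t, processed in order of arrival, with their levels.\<close>
definition labelled_edges :: "nat \<Rightarrow> sample \<Rightarrow> real \<Rightarrow> (edge \<times> nat) list" where
  "labelled_edges n \<omega> t =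
     foldl add_edge [] (sort_key (arrival n \<omega>) (map edge_decode (sorted_list_of_set (edge_code ` edges_upto n \<omega> t))))"

text \<open>Edge relation of G_k(t).\<close>
definition G_rel :: "nat \<Rightarrow> sample \<Rightarrow> real \<Rightarrow> nat \<Rightarrow> (nat \<times> nat) set" where
  "G_rel n \<omega> t k = level_rel (labelled_edges n \<omega> t) k"

text \<open>Number of vertices of the largest component of the graph on {0..<n} with edge relation R.\<close>
definition C1 :: "nat \<Rightarrow> (nat \<times> nat) set \<Rightarrow> nat" where
  "C1 n R = Max ((\<lambda>v. card {w. w < n \<and> (v, w) \<in> R\<^sup>*}) ` {..<n})"

text \<open>C_1(G_k(t))/n \<longrightarrow> f(t) in probability, uniformly in t \<ge> 0 (outer-probability form).\<close>
definition conv_unif_prob :: "nat \<Rightarrow> (real \<Rightarrow> real) \<Rightarrow> bool" where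
  "conv_unif_prob k f \<longleftrightarrow>
     (\<forall>\<epsilon>>0. \<forall>\<delta>>0. \<exists>N. \<forall>n\<ge>N. \<exists>A\<in>sets Omega. measure Omega A < \<delta> \<and>
        {\<omega>\<in>space Omega. \<exists>t\<ge>0. \<bar>real (C1 n (G_rel n \<omega> t k)) / real n - f t\<bar> > \<epsilon>} \<subseteq> A)"

end

theory Submission
  imports Defs
begin

text \<open>
  Everything is reduced to the expectations of \<open>C\<^sub>1(G\<^sub>k(t)) / n\<close>, which converge to \<open>\<rho>\<^sub>k(t)\<close>.
  Monotonicity in \<open>k\<close> is then the inclusion \<open>G\<^sub>k(t) \<subseteq> G\<^bsub>k-1\<^esub>(t)\<close>.

  For the thresholds let \<open>s = \<sigma>\<^bsub>k-1\<^esub>\<close> and \<open>s \<le> t < s + 1\<close>. An edge of \<open>G\<^sub>k(t)\<close> arriving before \<open>s\<close> joins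
  two vertices already connected in \<open>G\<^bsub>k-1\<^esub>(s)\<close>; since all components of the latter have size \<open>o(n)\<close>,
  there are only \<open>o(n)\<close> such edges. The edges arriving in \<open>(s, t]\<close> form a subcritical random graph with
  mean degree \<open>t - s < 1\<close>, and adding \<open>o(n)\<close> edges to it cannot create a component of linear size.

  For strictness let \<open>j = k - 1\<close>. A vertex that is isolated in \<open>G\<^sub>1\<close> until \<open>r < t\<close> and then receives exactly
  \<open>j\<close> edges by time \<open>t\<close>, all leading to the giant component of \<open>G\<^sub>j(r)\<close>, gives these edges the levels
  \<open>1, \<dots>, j\<close>, so it is attached to the giant in \<open>G\<^sub>j(t)\<close> but isolated in \<open>G\<^sub>k(t)\<close>. The expected proportion
  of such vertices is bounded below. That the giants of \<open>G\<^sub>j(r)\<close> and \<open>G\<^sub>k(t)\<close> lie in the same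
  component of \<open>G\<^sub>j(t)\<close> follows from continuity of \<open>\<rho>\<^sub>j\<close>: two disjoint components of linear size would merge
  shortly after \<open>t\<close>, which would make \<open>\<rho>\<^sub>j\<close> jump.
\<close>

section \<open>The probability space\<close>

abbreviation Ex1 :: "real measure" where
  "Ex1 \<equiv> density lborel (exponential_density 1)"

abbreviation EE :: "(sample \<Rightarrow> real) \<Rightarrow> real" where
  "EE f \<equiv> integral\<^sup>L Omega f"

lemma prob_space_Ex1: "prob_space Ex1"
  by (rule prob_space_exponential_density) simp

lemma prob_space_Omega: "prob_space Omega"
  unfolding Omega_def by (intro prob_space_PiM prob_space_Ex1)

lemma space_Omega [simp]: "space Omega = UNIV"
  by (simp add: Omega_def space_PiM)

interpretation Om: prob_space Omega
  by (rule prob_space_Omega)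

lemma prob_UNIV_Omega [simp]: "measure Omega UNIV = 1"
  using Om.prob_space by simp

lemma measurable_coord [measurable]: "(\<lambda>w. w i) \<in> borel_measurable Omega"
proof -
  have "(\<lambda>w. w i) \<in> measurable (PiM UNIV (\<lambda>_. Ex1)) Ex1"
    by (rule measurable_component_singleton) simp
  then show ?thesis
    by (simp add: Omega_def)
qed

lemma sets_pred: "Measurable.pred Omega P \<Longrightarrow> {w. P w} \<in> sets Omega"
  by (simp add: pred_def)

lemma measurable_into_Omega:
  assumes "\<And>i. (\<lambda>w. f w i) \<in> borel_measurable M"
  shows "f \<in> measurable M Omega"
  unfolding Omega_def
proof (rule measurable_PiM_single')
  show "(\<lambda>w. f w i) \<in> measurable M Ex1" for i
    using assms by simp
qed simp

definition bmeas :: "(sample \<Rightarrow> real) \<Rightarrow> bool" where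
  "bmeas f \<longleftrightarrow> f \<in> borel_measurable Omega \<and> (\<exists>B. \<forall>w. \<bar>f w\<bar> \<le> B)"

lemma bmeasD : "bmeas f \<Longrightarrow> f \<in> borel_measurable Omega"
  by (simp add: bmeas_def)

lemma bmeas_integrable:
  assumes "bmeas f"
  shows "integrable Omega f"
proof -
  obtain B where "\<And>w. \<bar>f w\<bar> \<le> B"
    using assms by (auto simp: bmeas_def)
  then show ?thesis
    using assms by (intro Om.integrable_const_bound[where B=B]) (auto simp: bmeas_def)
qed

lemma bmeasI: "f \<in> borel_measurable Omega \<Longrightarrow> (\<And>w. \<bar>f w\<bar> \<le> B) \<Longrightarrow> bmeas f"
  by (auto simp: bmeas_def)

lemma bmeas_const [simp, intro]: "bmeas (\<lambda>_. c)"
  by (rule bmeasI[where B="\<bar>c\<bar>"]) auto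

lemma bmeas_of_bool [intro]: "Measurable.pred Omega P \<Longrightarrow> bmeas (\<lambda>w. of_bool (P w))"
  by (rule bmeasI[where B=1]) auto

lemma bmeas_add [intro]:
  assumes "bmeas f" "bmeas g"
  shows "bmeas (\<lambda>w. f w + g w)"
proof -
  obtain B C where B: "\<And>w. \<bar>f w\<bar> \<le> B" and C: "\<And>w. \<bar>g w\<bar> \<le> C"
    using assms by (auto simp: bmeas_def)
  have "\<bar>f w + g w\<bar> \<le> B + C" for w
    using B[of w] C[of w] by linarith
  then show ?thesis
    using assms[THEN bmeasD] by (intro bmeasI[where B="B + C"]) auto
qed

lemma bmeas_mult [intro]:
  assumes "bmeas f" "bmeas g"
  shows "bmeas (\<lambda>w. f w * g w)"
proof -
  obtain B C where B: "\<And>w. \<bar>f w\<bar> \<le> B" and C: "\<And>w. \<bar>g w\<bar> \<le> C"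
    using assms by (auto simp: bmeas_def)
  have "\<bar>f w * g w\<bar> \<le> B * C" for w
    unfolding abs_mult using B[of w] C[of w] by (intro mult_mono) auto
  then show ?thesis
    using assms[THEN bmeasD] by (intro bmeasI[where B="B * C"]) auto
qed

lemma bmeas_uminus [intro]: "bmeas f \<Longrightarrow> bmeas (\<lambda>w. - f w)"
  using bmeas_mult[OF bmeas_const[of "-1"]] by simp

lemma bmeas_diff [intro]: "bmeas f \<Longrightarrow> bmeas g \<Longrightarrow> bmeas (\<lambda>w. f w - g w)"
  using bmeas_add[OF _ bmeas_uminus] by simp

lemma bmeas_divide [intro]: "bmeas f \<Longrightarrow> bmeas (\<lambda>w. f w / c)"
  using bmeas_mult[OF bmeas_const[of "1/c"]] by (simp add: mult.commute)

lemma bmeas_power2 [intro]: "bmeas f \<Longrightarrow> bmeas (\<lambda>w. (f w)\<^sup>2)"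
  unfolding power2_eq_square by (rule bmeas_mult)

lemma bmeas_sum [intro]: "(\<And>i. i \<in> I \<Longrightarrow> bmeas (f i)) \<Longrightarrow> bmeas (\<lambda>w. \<Sum>i\<in>I. f i w)"
  by (induction I rule: infinite_finite_induct) auto

lemma bmeas_prod [intro]: "(\<And>i. i \<in> I \<Longrightarrow> bmeas (f i)) \<Longrightarrow> bmeas (\<lambda>w. \<Prod>i\<in>I. f i w)"
  by (induction I rule: infinite_finite_induct) auto

lemma EE_sum: "(\<And>i. i \<in> I \<Longrightarrow> bmeas (f i)) \<Longrightarrow> EE (\<lambda>w. \<Sum>i\<in>I. f i w) = (\<Sum>i\<in>I. EE (f i))"
  by (intro Bochner_Integration.integral_sum bmeas_integrable)

lemma EE_add: "bmeas f \<Longrightarrow> bmeas g \<Longrightarrow> EE (\<lambda>w. f w + g w) = EE f + EE g"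
  by (intro Bochner_Integration.integral_add bmeas_integrable)

lemma EE_diff: "bmeas f \<Longrightarrow> bmeas g \<Longrightarrow> EE (\<lambda>w. f w - g w) = EE f - EE g"
  by (intro Bochner_Integration.integral_diff bmeas_integrable)

lemma EE_const [simp]: "EE (\<lambda>_. c) = c"
  using Om.prob_space by simp

lemma EE_mono:
  assumes "bmeas f" "bmeas g" "AE w in Omega. f w \<le> g w"
  shows "EE f \<le> EE g"
  using assms by (intro integral_mono_AE bmeas_integrable)

lemma EE_mono':
  assumes "bmeas f" "bmeas g" "\<And>w. f w \<le> g w"
  shows "EE f \<le> EE g"
  using assms by (intro EE_mono) auto

lemma EE_nonneg: "(\<And>w. 0 \<le> f w) \<Longrightarrow> 0 \<le> EE f"
  by (rule Bochner_Integration.integral_nonneg) simp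

lemma EE_of_bool: "Measurable.pred Omega P \<Longrightarrow> EE (\<lambda>w. of_bool (P w)) = measure Omega {w. P w}"
proof -
  assume [measurable]: "Measurable.pred Omega P"
  have "(\<lambda>w. of_bool (P w)) = (indicat_real {w. P w})"
    by (auto simp: indicator_def)
  then show ?thesis by simp
qed

definition ignores :: "edge set \<Rightarrow> (sample \<Rightarrow> 'b) \<Rightarrow> bool" where
  "ignores I g \<longleftrightarrow> (\<forall>w i x. i \<in> I \<longrightarrow> g (w(i := x)) = g w)"

lemma coord_indep:
  fixes h :: "real \<Rightarrow> real"
  assumes h[measurable]: "h \<in> borel_measurable borel" and hB: "\<And>x. \<bar>h x\<bar> \<le> B"
    and g: "bmeas g" and ign: "\<And>w x. g (w(i := x)) = g w"
  shows "EE (\<lambda>w. h (w i) * g w) = EE (\<lambda>w. h (w i)) * EE g"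
proof -
  interpret E: prob_space Ex1 by (rule prob_space_Ex1)
  interpret P: pair_prob_space Ex1 Omega ..
  have D: "distr (Ex1 \<Otimes>\<^sub>M Omega) Omega (\<lambda>(x, X). X(i := x)) = Omega"
    using distr_pair_PiM_eq_PiM[of UNIV "\<lambda>_. Ex1" i] prob_space_Ex1
    by (simp add: Omega_def)
  have [measurable]: "(\<lambda>(x, X). X(i := x)) \<in> measurable (Ex1 \<Otimes>\<^sub>M Omega) Omega"
    by (rule measurable_into_Omega) (auto simp: fun_upd_apply split_beta)
  note [measurable] = bmeasD[OF g]
  obtain C where C: "\<And>w. \<bar>g w\<bar> \<le> C"
    using g by (auto simp: bmeas_def)
  have *: "EE (\<lambda>w. h (w i) * f w) = integral\<^sup>L Ex1 h * EE f"
    if f[measurable]: "f \<in> borel_measurable Omega" and fB: "\<And>w. \<bar>f w\<bar> \<le> C"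
      and fi: "\<And>w x. f (w(i := x)) = f w" for f :: "sample \<Rightarrow> real" and C
  proof -
    have "EE (\<lambda>w. h (w i) * f w) =
        integral\<^sup>L (distr (Ex1 \<Otimes>\<^sub>M Omega) Omega (\<lambda>(x, X). X(i := x))) (\<lambda>w. h (w i) * f w)"
      by (simp add: D)
    also have "\<dots> = integral\<^sup>L (Ex1 \<Otimes>\<^sub>M Omega) (\<lambda>y. h (fst y) * f (snd y))"
      by (subst integral_distr) (auto simp: split_beta fi)
    also have "\<dots> = (\<integral>x. (\<integral>X. h x * f X \<partial>Omega) \<partial>Ex1)"
    proof (subst P.integral_fst'[symmetric])
      show "integrable (Ex1 \<Otimes>\<^sub>M Omega) (\<lambda>y. h (fst y) * f (snd y))"
      proof (rule P.integrable_const_bound[where B="B * C"])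
        have "\<bar>h a * f b\<bar> \<le> B * C" for a b
          unfolding abs_mult using hB[of a] fB[of b] by (intro mult_mono) auto
        then show "AE x in Ex1 \<Otimes>\<^sub>M Omega. norm (h (fst x) * f (snd x)) \<le> B * C" by auto
      qed measurable
    qed simp
    finally show ?thesis by simp
  qed
  show ?thesis
    using *[of g C] *[of "\<lambda>_. 1" 1] C ign g by (simp add: bmeasD)
qed

lemma coords_indep:
  fixes h :: "edge \<Rightarrow> real \<Rightarrow> real"
  assumes "finite I"
    and h[measurable]: "\<And>i. h i \<in> borel_measurable borel" and hB: "\<And>i x. \<bar>h i x\<bar> \<le> B"
    and g: "bmeas g" and ign: "ignores I g"
  shows "EE (\<lambda>w. (\<Prod>i\<in>I. h i (w i)) * g w) = (\<Prod>i\<in>I. EE (\<lambda>w. h i (w i))) * EE g"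
  using assms(1) ign
proof (induction I)
  case empty
  then show ?case by simp
next
  case (insert i I)
  have b: "bmeas (\<lambda>w. h j (w j))" for j
    by (rule bmeasI[OF _ hB]) measurable
  have ig: "ignores I g" "\<And>w x. g (w(i := x)) = g w"
    using insert.prems unfolding ignores_def by blast+
  have "EE (\<lambda>w. (\<Prod>i\<in>insert i I. h i (w i)) * g w) = EE (\<lambda>w. h i (w i) * ((\<Prod>i\<in>I. h i (w i)) * g w))"
    using insert.hyps by (simp add: mult.assoc)
  also have "\<dots> = EE (\<lambda>w. h i (w i)) * EE (\<lambda>w. (\<Prod>i\<in>I. h i (w i)) * g w)"
  proof (rule coord_indep[OF h hB])
    show "bmeas (\<lambda>w. (\<Prod>i\<in>I. h i (w i)) * g w)"
      using b g by (intro bmeas_mult bmeas_prod)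
    show "(\<Prod>j\<in>I. h j ((w(i := x)) j)) * g (w(i := x)) = (\<Prod>i\<in>I. h i (w i)) * g w" for w x
      using insert.hyps by (auto simp: ig intro!: prod.cong)
  qed
  finally show ?case
    using insert.IH ig insert.hyps by (simp add: mult.assoc)
qed

lemma prob_gt:
  assumes "0 \<le> s"
  shows "EE (\<lambda>w. of_bool (s < w i)) = exp (- s)"
proof -
  interpret E: prob_space Ex1 by (rule prob_space_Ex1)
  interpret product_prob_space "\<lambda>_. Ex1" "UNIV :: edge set" ..
  have "measure Omega {w. s < w i} = measure (distr Omega Ex1 (\<lambda>w. w i)) {s<..}"
    by (subst measure_distr) (auto simp: vimage_def)
  also have "distr Omega Ex1 (\<lambda>w. w i) = Ex1"
    unfolding Omega_def using PiM_component[of i] by simp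
  also have "measure Ex1 {s<..} = exp (- s)"
  proof -
    have "distributed Ex1 lborel (\<lambda>x. x) (exponential_density 1)"
      by (auto simp: distributed_def distr_id2 exponential_density_nonneg)
    from E.exponential_distributedD_gt[OF this assms] show ?thesis
      by (simp add: greaterThan_def)
  qed
  finally show ?thesis
    by (simp add: EE_of_bool)
qed

lemma prob_le:
  assumes "0 \<le> s"
  shows "EE (\<lambda>w. of_bool (w i \<le> s)) = 1 - exp (- s)"
proof -
  have "EE (\<lambda>w. of_bool (w i \<le> s)) = EE (\<lambda>w. 1 - of_bool (s < w i))"
    by (intro Bochner_Integration.integral_cong) auto
  also have "\<dots> = 1 - exp (- s)"
    using prob_gt[OF assms, of i] by (subst EE_diff) auto
  finally show ?thesis .
qed

lemma prob_le_bound: "0 \<le> s \<Longrightarrow> EE (\<lambda>w. of_bool (w i \<le> s)) \<le> s"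
  using prob_le[of s i] exp_ge_add_one_self[of "-s"] by simp

lemma prob_interval:
  assumes "0 \<le> s" "s \<le> t"
  shows "EE (\<lambda>w. of_bool (s < w i \<and> w i \<le> t)) = exp (- s) - exp (- t)"
proof -
  have "EE (\<lambda>w. of_bool (s < w i \<and> w i \<le> t)) = EE (\<lambda>w. of_bool (s < w i) - of_bool (t < w i))"
    using assms by (intro Bochner_Integration.integral_cong) auto
  also have "\<dots> = exp (- s) - exp (- t)"
    using prob_gt[of s i] prob_gt[of t i] assms by (subst EE_diff) auto
  finally show ?thesis .
qed

definition good :: "sample \<Rightarrow> bool" where
  "good w \<longleftrightarrow> (\<forall>x. 0 < w x) \<and> (\<forall>u v (m::nat). \<exists>j. real m < w (u, v, j))"

lemma AE_good: "AE w in Omega. good w"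
proof -
  have 1: "AE w in Omega. 0 < w x" for x
  proof -
    have "measure Omega {w. 0 < w x} = 1"
      using prob_gt[of 0 x] by (simp add: EE_of_bool)
    then show ?thesis
      using Om.prob_Collect_eq_1[of "\<lambda>w. 0 < w x"] sets_pred[of "\<lambda>w. 0 < w x"] by simp
  qed
  have 2: "AE w in Omega. \<exists>j. real m < w (u, v, j)" for u v m
  proof -
    let ?N = "{w. \<forall>j. w (u, v, j) \<le> real m}"
    let ?q = "1 - exp (- real m)"
    have "measure Omega ?N \<le> ?q ^ J" for J
    proof -
      have "measure Omega ?N = EE (\<lambda>w. of_bool (\<forall>j. w (u, v, j) \<le> real m))"
        by (simp add: EE_of_bool)
      also have "\<dots> \<le> EE (\<lambda>w. (\<Prod>i\<in>(\<lambda>j. (u, v, j)) ` {..<J}. of_bool (w i \<le> real m)) * 1)"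
        by (intro EE_mono' bmeas_mult bmeas_prod bmeas_of_bool bmeas_const) (auto simp: prod.neutral intro!: prod_nonneg)
      also have "\<dots> = (\<Prod>i\<in>(\<lambda>j. (u, v, j)) ` {..<J}. EE (\<lambda>w. of_bool (w i \<le> real m))) * EE (\<lambda>_. 1)"
        by (rule coords_indep[where B=1]) (auto simp: ignores_def)
      also have "\<dots> = ?q ^ J"
        by (simp add: prob_le card_image inj_on_def)
      finally show ?thesis .
    qed
    moreover have "(\<lambda>J. ?q ^ J) \<longlonglongrightarrow> 0"
      by (rule LIMSEQ_realpow_zero) auto
    ultimately have "measure Omega ?N \<le> 0"
      by (intro LIMSEQ_le_const) auto
    then have "emeasure Omega ?N = 0"
      by (simp add: Om.emeasure_eq_measure measure_le_0_iff)
    then show ?thesis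
      using sets_pred[of "\<lambda>w. \<forall>j. w (u, v, j) \<le> real m"] by (intro AE_I[of _ _ ?N]) (auto simp: not_less)
  qed
  show ?thesis
    unfolding good_def AE_conj_iff AE_all_countable using 1 2 by simp
qed

section \<open>Levels and components\<close>

abbreviation ends :: "edge \<Rightarrow> nat \<times> nat" where
  "ends x \<equiv> (fst x, fst (snd x))"

definition lab :: "edge list \<Rightarrow> (edge \<times> nat) list" where
  "lab M = foldl add_edge [] M"

definition arr_list :: "nat \<Rightarrow> sample \<Rightarrow> real \<Rightarrow> edge list" where
  "arr_list n w t =
     sort_key (arrival n w) (map edge_decode (sorted_list_of_set (edge_code ` edges_upto n w t)))"

lemma labelled_edges_eq: "labelled_edges n w t = lab (arr_list n w t)"
  by (simp add: labelled_edges_def lab_def arr_list_def)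

lemma G_rel_eq: "G_rel n w t k = level_rel (lab (arr_list n w t)) k"
  by (simp add: G_rel_def labelled_edges_eq)

lemma lab_Nil [simp]: "lab [] = []"
  by (simp add: lab_def)

lemma lab_snoc [simp]: "lab (M @ [x]) = lab M @ [(x, new_level (lab M) x)]"
  by (simp add: lab_def add_edge_def)

lemma set_lab_append: "set (lab M) \<subseteq> set (lab (M @ N))"
proof (induction N rule: rev_induct)
  case (snoc x N)
  then show ?case
    using lab_snoc[of "M @ N" x] by auto
qed simp

lemma fst_lab: "fst ` set (lab M) = set M"
  by (induction M rule: rev_induct) auto

lemma lab_split:
  assumes "(x, l) \<in> set (lab M)"
  shows "\<exists>P Q. M = P @ x # Q \<and> l = new_level (lab P) x"
  using assms
proof (induction M rule: rev_induct)
  case (snoc y M)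
  show ?case
  proof (cases "(x, l) \<in> set (lab M)")
    case True
    then obtain P Q where "M = P @ x # Q" "l = new_level (lab P) x"
      using snoc.IH by blast
    then show ?thesis
      by (intro exI[of _ P] exI[of _ "Q @ [y]"]) simp
  next
    case False
    then show ?thesis
      using snoc.prems by auto
  qed
qed simp

lemma level_rel_set_mono: "set L \<subseteq> set L' \<Longrightarrow> level_rel L k \<subseteq> level_rel L' k"
  by (fastforce simp: level_rel_def)

lemma level_rel_antimono: "k \<le> k' \<Longrightarrow> level_rel L k' \<subseteq> level_rel L k"
  by (fastforce simp: level_rel_def)

lemma sym_level_rel: "sym (level_rel L k)"
  by (auto simp: sym_def level_rel_def)

lemma level_relI: "(x, l) \<in> set L \<Longrightarrow> k \<le> l \<Longrightarrow> ends x \<in> level_rel L k"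
  unfolding level_rel_def by blast

lemma level_rel_eq_empty:
  obtains m where "level_rel L m = {}"
proof
  have "l \<le> Max (snd ` set L)" if "(x, l) \<in> set L" for x l
    using that by (intro Max_ge) force+
  then show "level_rel L (Suc (Max (snd ` set L))) = {}"
    unfolding level_rel_def by fastforce
qed

lemma connected_below_level: "1 \<le> i \<Longrightarrow> i < new_level L x \<Longrightarrow> ends x \<in> (level_rel L i)\<^sup>*"
  unfolding new_level_def using not_less_Least by blast

lemma new_level_not_connected:
  assumes "fst x \<noteq> fst (snd x)"
  shows "1 \<le> new_level L x" "ends x \<notin> (level_rel L (new_level L x))\<^sup>*"
proof -
  obtain m where m: "level_rel L m = {}"
    by (rule level_rel_eq_empty)
  have "level_rel L (Suc m) = {}"
    using level_rel_antimono[of m "Suc m" L] m by auto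
  then have "1 \<le> Suc m \<and> ends x \<notin> (level_rel L (Suc m))\<^sup>*"
    using assms by simp
  then have "1 \<le> new_level L x \<and> ends x \<notin> (level_rel L (new_level L x))\<^sup>*"
    unfolding new_level_def by (rule LeastI)
  then show "1 \<le> new_level L x" "ends x \<notin> (level_rel L (new_level L x))\<^sup>*" by auto
qed

lemma rtrancl_level_rel_append:
  "(a, b) \<in> (level_rel (lab M) k)\<^sup>* \<Longrightarrow> (a, b) \<in> (level_rel (lab (M @ N)) k)\<^sup>*"
  using rtrancl_mono[OF level_rel_set_mono[OF set_lab_append]] by blast

lemma rtrancl_level_rel_antimono:
  "(a, b) \<in> (level_rel L k')\<^sup>* \<Longrightarrow> k \<le> k' \<Longrightarrow> (a, b) \<in> (level_rel L k)\<^sup>*"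
  using rtrancl_mono[OF level_rel_antimono] by blast

lemma rtrancl_level_rel_sym: "(a, b) \<in> (level_rel L k)\<^sup>* \<Longrightarrow> (b, a) \<in> (level_rel L k)\<^sup>*"
  using sym_rtrancl[OF sym_level_rel] by (rule symD)

definition crossing :: "nat set \<Rightarrow> nat set \<Rightarrow> edge \<Rightarrow> bool" where
  "crossing A B x \<longleftrightarrow> fst x \<in> A \<and> fst (snd x) \<in> B \<or> fst x \<in> B \<and> fst (snd x) \<in> A"

text \<open>Each crossing edge joins \<open>A\<close> and \<open>B\<close> at the lowest level at which they are still separated.\<close>
lemma merge_by_crossing_edges:
  assumes A: "\<And>a a'. a \<in> A \<Longrightarrow> a' \<in> A \<Longrightarrow> (a, a') \<in> (level_rel (lab M) j)\<^sup>*"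
    and B: "\<And>a a'. a \<in> B \<Longrightarrow> a' \<in> B \<Longrightarrow> (a, a') \<in> (level_rel (lab M) j)\<^sup>*"
    and loop: "\<And>x. x \<in> set N \<Longrightarrow> fst x \<noteq> fst (snd x)"
    and i: "1 \<le> i" "i \<le> j" "i \<le> length (filter (crossing A B) N)"
    and ab: "a \<in> A" "b \<in> B"
  shows "(a, b) \<in> (level_rel (lab (M @ N)) i)\<^sup>*"
  using loop i ab
proof (induction N arbitrary: i a b rule: rev_induct)
  case (snoc x N)
  let ?l = "new_level (lab (M @ N)) x"
  have lab: "lab (M @ N @ [x]) = lab (M @ N) @ [(x, ?l)]"
    using lab_snoc[of "M @ N" x] by simp
  show ?case
  proof (cases "i \<le> length (filter (crossing A B) N)")
    case True
    then have "(a, b) \<in> (level_rel (lab (M @ N)) i)\<^sup>*"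
      using snoc by auto
    then show ?thesis
      using rtrancl_level_rel_append[of a b "M @ N" i "[x]"] by simp
  next
    case False
    then have x: "crossing A B x" and len: "i = Suc (length (filter (crossing A B) N))"
      using snoc.prems by (auto split: if_splits)
    have "i \<le> ?l"
    proof (rule ccontr)
      assume "\<not> i \<le> ?l"
      moreover have "1 \<le> ?l" "ends x \<notin> (level_rel (lab (M @ N)) ?l)\<^sup>*"
        using new_level_not_connected[of x] snoc.prems(1)[of x] by auto
      moreover have "\<forall>a\<in>A. \<forall>b\<in>B. (a, b) \<in> (level_rel (lab (M @ N)) ?l)\<^sup>*"
        if "1 \<le> ?l" "?l < i"
        using snoc.IH[of ?l] snoc.prems that len by auto
      ultimately show False
        using x rtrancl_level_rel_sym[of "fst (snd x)" "fst x"] unfolding crossing_def by force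
    qed
    then have ex: "ends x \<in> level_rel (lab (M @ N @ [x])) i"
      unfolding lab by (intro level_relI[of x ?l]) auto
    have conn: "(c, c') \<in> (level_rel (lab (M @ N @ [x])) i)\<^sup>*"
      if "c \<in> A \<and> c' \<in> A \<or> c \<in> B \<and> c' \<in> B" for c c'
      using that A B \<open>i \<le> j\<close> rtrancl_level_rel_append rtrancl_level_rel_antimono by meson
    obtain a' b' where "a' \<in> A" "b' \<in> B" "(a', b') \<in> (level_rel (lab (M @ N @ [x])) i)\<^sup>*"
      using x ex symD[OF sym_level_rel ex] unfolding crossing_def by blast
    then show ?thesis
      using conn[of a a'] conn[of b' b] snoc.prems by (meson rtrancl_trans)
  qed
qed simp

definition incident :: "nat \<Rightarrow> edge \<Rightarrow> bool" where
  "incident v x \<longleftrightarrow> fst x = v \<or> fst (snd x) = v"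

text \<open>If the star edges of a new vertex all lead to a set that is connected at level \<open>j\<close>,
  they receive the levels \<open>1, 2, 3, \<dots>\<close> in their order of arrival.\<close>
lemma star_levels:
  assumes W: "\<And>a a'. a \<in> W \<Longrightarrow> a' \<in> W \<Longrightarrow> (a, a') \<in> (level_rel (lab M) j)\<^sup>*"
    and M: "\<And>x. x \<in> set M \<Longrightarrow> \<not> incident v x"
    and N: "\<And>x. x \<in> set N \<Longrightarrow> incident v x \<Longrightarrow> crossing {v} W x \<and> fst x \<noteq> fst (snd x)"
    and j: "length (filter (incident v) N) \<le> j"
  shows "(\<forall>(x, l) \<in> set (lab (M @ N)). incident v x \<longrightarrow> l \<le> length (filter (incident v) N)) \<and>
    (\<forall>i b. 1 \<le> i \<longrightarrow> i \<le> length (filter (incident v) N) \<longrightarrow> b \<in> W \<longrightarrow>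
       (v, b) \<in> (level_rel (lab (M @ N)) i)\<^sup>*)"
  using N j
proof (induction N rule: rev_induct)
  case Nil
  then show ?case
    using M fst_lab[of M] by force
next
  case (snoc x N)
  let ?c = "length (filter (incident v) N)"
  let ?L = "lab (M @ N)"
  let ?l = "new_level ?L x"
  have lab: "lab (M @ N @ [x]) = ?L @ [(x, ?l)]"
    using lab_snoc[of "M @ N" x] by simp
  have IH: "\<And>x l. (x, l) \<in> set ?L \<Longrightarrow> incident v x \<Longrightarrow> l \<le> ?c"
    "\<And>i b. 1 \<le> i \<Longrightarrow> i \<le> ?c \<Longrightarrow> b \<in> W \<Longrightarrow> (v, b) \<in> (level_rel ?L i)\<^sup>*"
    using snoc.IH snoc.prems by (auto split: if_splits)
  have up: "(a, b) \<in> (level_rel ?L i)\<^sup>* \<Longrightarrow> (a, b) \<in> (level_rel (lab (M @ N @ [x])) i)\<^sup>*" for a b i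
    using rtrancl_level_rel_append[of a b "M @ N" i "[x]"] by simp
  show ?case
  proof (cases "incident v x")
    case False
    then show ?thesis
      using IH up unfolding lab by auto
  next
    case True
    then have x: "crossing {v} W x" "fst x \<noteq> fst (snd x)"
      using snoc.prems by auto
    then obtain b where b: "b \<in> W" "b \<noteq> v" "ends x = (v, b) \<or> ends x = (b, v)"
      unfolding crossing_def by auto
    have "?l = Suc ?c"
      unfolding new_level_def
    proof (rule Least_equality)
      have "v \<notin> Domain (level_rel ?L (Suc ?c))"
        using IH(1) by (fastforce simp: level_rel_def incident_def)
      then have "(v, b) \<notin> (level_rel ?L (Suc ?c))\<^sup>*"
        using \<open>b \<noteq> v\<close> by (metis DomainI converse_rtranclE)
      then show "1 \<le> Suc ?c \<and> ends x \<notin> (level_rel ?L (Suc ?c))\<^sup>*"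
        using b(3) rtrancl_level_rel_sym[of b v] by auto
    next
      fix i
      assume i: "1 \<le> i \<and> ends x \<notin> (level_rel ?L i)\<^sup>*"
      show "Suc ?c \<le> i"
      proof (rule ccontr)
        assume "\<not> Suc ?c \<le> i"
        then have "(v, b) \<in> (level_rel ?L i)\<^sup>*"
          using i b(1) IH(2) by auto
        then show False
          using i b(3) rtrancl_level_rel_sym[of v b] by auto
      qed
    qed
    note l = this
    have "(v, b') \<in> (level_rel (lab (M @ N @ [x])) i)\<^sup>*"
      if "1 \<le> i" "i \<le> Suc ?c" "b' \<in> W" for i b'
    proof (cases "i \<le> ?c")
      case True
      then show ?thesis
        using IH(2) up that by blast
    next
      case False
      then have "i = Suc ?c"
        using that by simp
      then have e: "ends x \<in> level_rel (lab (M @ N @ [x])) i"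
        unfolding lab by (intro level_relI[of x ?l]) (auto simp: l)
      then have "(v, b) \<in> (level_rel (lab (M @ N @ [x])) i)\<^sup>*"
        using b(3) symD[OF sym_level_rel e] by auto
      moreover have "i \<le> j"
        using \<open>i = Suc ?c\<close> snoc.prems(2) True by simp
      then have "(b, b') \<in> (level_rel (lab (M @ N @ [x])) i)\<^sup>*"
        using W[of b b'] b(1) that(3) rtrancl_level_rel_append rtrancl_level_rel_antimono by meson
      ultimately show ?thesis by (rule rtrancl_trans)
    qed
    moreover have "l' \<le> Suc ?c" if "(x', l') \<in> set (lab (M @ N @ [x]))" "incident v x'" for x' l'
      using that IH(1)[of x' l'] unfolding lab by (auto simp: l)
    ultimately show ?thesis
      using True by auto
  qed
qed

definition component :: "nat \<Rightarrow> (nat \<times> nat) set \<Rightarrow> nat \<Rightarrow> nat set" where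
  "component n R v = {u. u < n \<and> (v, u) \<in> R\<^sup>*}"

lemma finite_component [simp]: "finite (component n R v)"
  by (simp add: component_def)

lemma C1_eq: "C1 n R = Max ((\<lambda>v. card (component n R v)) ` {..<n})"
  by (simp add: C1_def component_def)

lemma card_component_le_C1: "v < n \<Longrightarrow> card (component n R v) \<le> C1 n R"
  unfolding C1_eq by (intro Max_ge) auto

lemma C1_attained:
  assumes "0 < n"
  obtains v where "v < n" "card (component n R v) = C1 n R"
proof -
  have "C1 n R \<in> (\<lambda>v. card (component n R v)) ` {..<n}"
    unfolding C1_eq using assms by (intro Max_in) auto
  then show ?thesis
    using that by auto
qed

lemma card_component_le: "card (component n R v) \<le> n"
  using card_mono[of "{..<n}" "component n R v"] by (auto simp: component_def)

lemma C1_le: "0 < n \<Longrightarrow> C1 n R \<le> n"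
  using card_component_le by (metis C1_attained)

lemma component_mono: "R \<subseteq> R' \<Longrightarrow> component n R v \<subseteq> component n R' v"
  unfolding component_def using rtrancl_mono by blast

lemma C1_mono:
  assumes "0 < n" "R \<subseteq> R'"
  shows "C1 n R \<le> C1 n R'"
proof -
  obtain v where v: "v < n" "card (component n R v) = C1 n R"
    using assms C1_attained by blast
  have "card (component n R v) \<le> card (component n R' v)"
    by (intro card_mono component_mono assms finite_component)
  then show ?thesis
    using v card_component_le_C1[of v n R'] by simp
qed

lemma edge_decode_code [simp]: "edge_decode (edge_code x) = x"
  by (simp add: edge_decode_def edge_code_def)

lemma inj_edge_code: "inj edge_code"
  by (rule inj_on_inverseI[where g=edge_decode]) simp

lemma set_arr_list:
  assumes "finite (edges_upto n w t)"
  shows "set (arr_list n w t) = edges_upto n w t"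
  using assms by (simp add: arr_list_def image_image)

lemma sort_key_cong_on:
  "(\<And>x. x \<in> set xs \<Longrightarrow> f x = g x) \<Longrightarrow> sort_key f xs = sort_key g xs"
proof (induction xs)
  case (Cons a xs)
  have "insort_key f a ys = insort_key g a ys" if "\<And>y. y \<in> insert a (set ys) \<Longrightarrow> f y = g y" for ys
    using that by (induction ys) auto
  from this[of "sort_key g xs"] show ?case
    using Cons by simp
qed simp

lemma arr_list_filter:
  assumes fin: "finite (edges_upto n w t)"
    and eq: "edges_upto n w' t' = {x \<in> edges_upto n w t. Q x}"
    and arr: "\<And>x. x \<in> edges_upto n w t \<Longrightarrow> Q x \<Longrightarrow> arrival n w' x = arrival n w x"
  shows "arr_list n w' t' = filter Q (arr_list n w t)"
proof -
  let ?S = "sorted_list_of_set (edge_code ` edges_upto n w t)"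
  have S: "sorted_list_of_set (edge_code ` edges_upto n w' t') = filter (Q \<circ> edge_decode) ?S"
    by (rule sorted_distinct_set_unique) (auto simp: fin eq image_iff intro: sorted_wrt_filter)
  have "arr_list n w' t' = sort_key (arrival n w') (filter Q (map edge_decode ?S))"
    unfolding arr_list_def S by (simp add: filter_map)
  also have "\<dots> = sort_key (arrival n w) (filter Q (map edge_decode ?S))"
    using fin arr by (intro sort_key_cong_on) auto
  finally show ?thesis
    by (simp add: arr_list_def filter_sort)
qed

lemma sorted_filter_split:
  fixes s :: "'b :: linorder"
  assumes "sorted (map f xs)"
  shows "xs = filter (\<lambda>x. f x \<le> s) xs @ filter (\<lambda>x. s < f x) xs"
  using assms
proof (induction xs)
  case (Cons a xs)
  show ?case
  proof (cases "f a \<le> s")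
    case True
    then show ?thesis
      using Cons by (simp add: not_less)
  next
    case False
    then have "\<forall>x \<in> set (a # xs). s < f x"
      using Cons.prems by auto
    then have "filter (\<lambda>x. f x \<le> s) (a # xs) = []" "filter (\<lambda>x. s < f x) (a # xs) = a # xs"
      by (auto simp: filter_empty_conv not_le filter_id_conv simp del: filter.simps)
    then show ?thesis
      by simp
  qed
qed simp

lemma arr_list_prefix:
  assumes fin: "finite (edges_upto n w t)" and "s \<le> t"
  shows "arr_list n w t = arr_list n w s @ filter (\<lambda>x. s < arrival n w x) (arr_list n w t)"
proof -
  have "arr_list n w s = filter (\<lambda>x. arrival n w x \<le> s) (arr_list n w t)"
    by (rule arr_list_filter[OF fin]) (use \<open>s \<le> t\<close> in \<open>auto simp: edges_upto_def\<close>)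
  moreover have "sorted (map (arrival n w) (arr_list n w t))"
    by (simp add: arr_list_def)
  ultimately show ?thesis
    using sorted_filter_split[of "arrival n w" "arr_list n w t" s] by simp
qed

text \<open>Choosing \<open>c\<close> beyond the time horizon removes all edges on the selected pairs.\<close>
definition wipe :: "(nat \<times> nat \<Rightarrow> bool) \<Rightarrow> real \<Rightarrow> sample \<Rightarrow> sample" where
  "wipe P c w = (\<lambda>x. if P (ends x) then c else w x)"

lemma arrival_wipe: "arrival n (wipe P c w) x = (if P (ends x) then real n * (real (snd (snd x)) + 1) * c else arrival n w x)"
  by (simp add: arrival_def wipe_def)

lemma arr_list_wipe:
  assumes fin: "finite (edges_upto n w t)" and n: "1 \<le> n" and c: "0 \<le> t" "t < c"
  shows "arr_list n (wipe P c w) t = filter (\<lambda>x. \<not> P (ends x)) (arr_list n w t)"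
proof (rule arr_list_filter[OF fin])
  have "\<not> real n * (real j + 1) * c \<le> t" for j
  proof -
    have "1 \<le> real n * (real j + 1)"
      using mult_mono[of 1 "real n" 1 "real j + 1"] n by simp
    then have "1 * c \<le> real n * (real j + 1) * c"
      using c by (intro mult_right_mono) auto
    then show ?thesis
      using c by linarith
  qed
  then show "edges_upto n (wipe P c w) t = {x \<in> edges_upto n w t. \<not> P (ends x)}"
    by (auto simp: edges_upto_def arrival_wipe split: if_splits)
qed (simp add: arrival_wipe)

lemma arrival_ge_coord:
  assumes "good w" "i \<le> j"
  shows "real n * w (u, v, i) \<le> arrival n w (u, v, j)"
proof -
  have pos: "0 \<le> w x" for x
    using assms(1) unfolding good_def by (blast intro: less_imp_le)
  then have "w (u, v, i) \<le> (\<Sum>k\<le>j. w (u, v, k))"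
    using assms(2) by (intro member_le_sum) auto
  then show ?thesis
    by (simp add: arrival_def mult_left_mono)
qed

lemma arrival_0: "arrival n w (u, v, 0) = real n * w (u, v, 0)"
  by (simp add: arrival_def)

lemma finite_edges_upto:
  assumes g: "good w" and n: "1 \<le> n"
  shows "finite (edges_upto n w t)"
proof -
  obtain m :: nat where m: "t \<le> real m"
    using real_arch_simple by blast
  have "\<forall>u v. \<exists>j. real m < w (u, v, j)"
    using g unfolding good_def by blast
  then obtain J where J: "\<And>u v. real m < w (u, v, J u v)"
    by metis
  have "j < J u v" if "arrival n w (u, v, j) \<le> t" for u v j
  proof (rule ccontr)
    assume "\<not> j < J u v"
    then have "real n * w (u, v, J u v) \<le> arrival n w (u, v, j)"
      using arrival_ge_coord[OF g] by simp
    moreover have "1 * w (u, v, J u v) \<le> real n * w (u, v, J u v)"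
      using n g unfolding good_def by (intro mult_right_mono) (auto intro: less_imp_le)
    ultimately show False
      using J[of u v] m that by linarith
  qed
  then have "edges_upto n w t \<subseteq> (SIGMA u : {..<n}. SIGMA v : {..<n}. {..<J u v})"
    by (auto simp: edges_upto_def)
  then show ?thesis
    by (rule finite_subset) auto
qed

section \<open>Measurability and convergence of expectations\<close>

lemma measurable_arrival [measurable]: "(\<lambda>w. arrival n w x) \<in> borel_measurable Omega"
  unfolding arrival_def by measurable

lemma pred_edges_upto [measurable]: "Measurable.pred Omega (\<lambda>w. x \<in> edges_upto n w t)"
  unfolding edges_upto_def mem_Collect_eq by measurable

lemma measurable_insort_key:
  fixes L :: "'a \<Rightarrow> 'b :: countable list" and f :: "'a \<Rightarrow> 'b \<Rightarrow> real"
  assumes f[measurable]: "\<And>x. (\<lambda>w. f w x) \<in> borel_measurable M"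
    and L: "L \<in> measurable M (count_space UNIV)"
  shows "(\<lambda>w. insort_key (f w) x (L w)) \<in> measurable M (count_space UNIV)"
proof (rule measurable_compose_countable[OF _ L])
  show "(\<lambda>w. insort_key (f w) x ys) \<in> measurable M (count_space UNIV)" for ys
  proof (induction ys)
    case (Cons y ys)
    note [measurable] = Cons
    have "(\<lambda>w. if f w x \<le> f w y then x # y # ys else y # insort_key (f w) x ys)
        \<in> measurable M (count_space UNIV)"
      by measurable
    then show ?case by simp
  qed simp
qed

lemma measurable_sort_key:
  fixes L :: "'a \<Rightarrow> 'b :: countable list" and f :: "'a \<Rightarrow> 'b \<Rightarrow> real"
  assumes f: "\<And>x. (\<lambda>w. f w x) \<in> borel_measurable M"
    and L: "L \<in> measurable M (count_space UNIV)"
  shows "(\<lambda>w. sort_key (f w) (L w)) \<in> measurable M (count_space UNIV)"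
proof (rule measurable_compose_countable[OF _ L])
  show "(\<lambda>w. sort_key (f w) xs) \<in> measurable M (count_space UNIV)" for xs
    by (induction xs) (auto intro: measurable_insort_key f)
qed

lemma measurable_sorted_list_of_set:
  fixes S :: "'a \<Rightarrow> nat set"
  assumes S[measurable]: "\<And>x. Measurable.pred M (\<lambda>w. x \<in> S w)"
  shows "(\<lambda>w. sorted_list_of_set (S w)) \<in> measurable M (count_space UNIV)"
proof (subst measurable_count_space_eq2_countable, intro conjI ballI)
  fix L :: "nat list"
  have eq: "{w \<in> space M. S w = A} \<in> sets M" for A
  proof -
    have "{w \<in> space M. \<forall>x. x \<in> S w \<longleftrightarrow> x \<in> A} \<in> sets M"
      by measurable
    then show ?thesis
      by (simp add: set_eq_iff)
  qed
  have fin: "{w \<in> space M. finite (S w)} \<in> sets M"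
  proof -
    have "{w \<in> space M. \<exists>m. \<forall>x. x \<in> S w \<longrightarrow> x < m} \<in> sets M"
      by measurable
    then show ?thesis
      unfolding finite_nat_iff_bounded subset_eq Ball_def lessThan_iff .
  qed
  have "(\<lambda>w. sorted_list_of_set (S w)) -` {L} \<inter> space M =
    (if L = [] then {w \<in> space M. S w = {}} \<union> (space M - {w \<in> space M. finite (S w)})
     else if sorted L \<and> distinct L then {w \<in> space M. S w = set L} else {})"
  proof -
    have "sorted_list_of_set A = L \<longleftrightarrow>
        (if L = [] then A = {} \<or> infinite A else sorted L \<and> distinct L \<and> A = set L)" for A
    proof (cases "finite A")
      case True
      then show ?thesis
        using sorted_list_of_set_unique[of A L] 
        by (auto simp: strict_sorted_iff sorted_list_of_set.idem_if_sorted_distinct)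
    qed auto
    note * = this
    show ?thesis
    proof (rule set_eqI)
      show "w \<in> (\<lambda>w. sorted_list_of_set (S w)) -` {L} \<inter> space M \<longleftrightarrow> w \<in> (if L = [] then {w \<in> space M. S w = {}} \<union> (space M - {w \<in> space M. finite (S w)})
         else if sorted L \<and> distinct L then {w \<in> space M. S w = set L} else {})" for w
        using *[of "S w"] by auto
    qed
  qed
  also have "\<dots> \<in> sets M"
    using eq fin by auto
  finally show "(\<lambda>w. sorted_list_of_set (S w)) -` {L} \<inter> space M \<in> sets M" .
qed simp

lemma measurable_arr_list [measurable]:
  "(\<lambda>w. arr_list n w t) \<in> measurable Omega (count_space UNIV)"
proof -
  have "Measurable.pred Omega (\<lambda>w. x \<in> edge_code ` edges_upto n w t)" for x
  proof -
    have "Measurable.pred Omega (\<lambda>w. \<exists>e. e \<in> edges_upto n w t \<and> x = edge_code e)"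
      by measurable
    then show ?thesis
      by (simp add: image_iff Bex_def)
  qed
  then have "(\<lambda>w. sorted_list_of_set (edge_code ` edges_upto n w t)) \<in> measurable Omega (count_space UNIV)"
    by (rule measurable_sorted_list_of_set)
  then have "(\<lambda>w. map edge_decode (sorted_list_of_set (edge_code ` edges_upto n w t)))
      \<in> measurable Omega (count_space UNIV)"
    by measurable
  then show ?thesis
    unfolding arr_list_def by (intro measurable_sort_key) auto
qed

lemma measurable_wipe [measurable]: "wipe P c \<in> measurable Omega Omega"
  by (rule measurable_into_Omega) (simp add: wipe_def)

lemma measurable_arr_list_wipe [measurable]:
  "(\<lambda>w. arr_list n (wipe P c w) t) \<in> measurable Omega (count_space UNIV)"
  using measurable_compose[OF measurable_wipe measurable_arr_list] .

lemma pred_arr_list: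
  "Measurable.pred Omega (\<lambda>w. Q (arr_list n w t))"
  by measurable

lemma pred_arr_list_wipe:
  "Measurable.pred Omega (\<lambda>w. Q (arr_list n (wipe P c w) t))"
  by measurable

definition c1_frac :: "nat \<Rightarrow> nat \<Rightarrow> real \<Rightarrow> sample \<Rightarrow> real" where
  "c1_frac k n t w = real (C1 n (G_rel n w t k)) / real n"

lemma c1_frac_bounds: "1 \<le> n \<Longrightarrow> 0 \<le> c1_frac k n t w" "1 \<le> n \<Longrightarrow> c1_frac k n t w \<le> 1"
  using C1_le[of n "G_rel n w t k"] by (auto simp: c1_frac_def)

lemma measurable_c1_frac [measurable]: "c1_frac k n t \<in> borel_measurable Omega"
  unfolding c1_frac_def G_rel_eq by measurable

lemma bmeas_c1_frac: "1 \<le> n \<Longrightarrow> bmeas (c1_frac k n t)"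
  using c1_frac_bounds[of n k t] by (intro bmeasI[where B=1]) auto

lemma conv_prob:
  assumes conv: "conv_unif_prob k f" and t: "0 \<le> t" and "0 < \<epsilon>"
  shows "(\<lambda>n. measure Omega {w. \<epsilon> < \<bar>c1_frac k n t w - f t\<bar>}) \<longlonglongrightarrow> 0"
proof (rule LIMSEQ_I)
  fix r :: real
  assume "0 < r"
  then obtain N where N: "\<And>n. N \<le> n \<Longrightarrow> \<exists>A\<in>sets Omega. measure Omega A < r \<and>
      {w\<in>space Omega. \<exists>t\<ge>0. \<bar>real (C1 n (G_rel n w t k)) / real n - f t\<bar> > \<epsilon>} \<subseteq> A"
    using conv \<open>0 < \<epsilon>\<close> unfolding conv_unif_prob_def by blast
  have "norm (measure Omega {w. \<epsilon> < \<bar>c1_frac k n t w - f t\<bar>} - 0) < r" if "N \<le> n" for n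
  proof -
    obtain A where A: "A \<in> sets Omega" "measure Omega A < r"
      "{w\<in>space Omega. \<exists>t\<ge>0. \<bar>real (C1 n (G_rel n w t k)) / real n - f t\<bar> > \<epsilon>} \<subseteq> A"
      using N \<open>N \<le> n\<close> by blast
    have "measure Omega {w. \<epsilon> < \<bar>c1_frac k n t w - f t\<bar>} \<le> measure Omega A"
      using A t by (intro Om.finite_measure_mono) (auto simp: c1_frac_def)
    then show ?thesis
      using A by simp
  qed
  then show "\<exists>N. \<forall>n\<ge>N. norm (measure Omega {w. \<epsilon> < \<bar>c1_frac k n t w - f t\<bar>} - 0) < r"
    by blast
qed

lemma measure_tendsto_0_mono:
  assumes "(\<lambda>n. measure Omega {w. Q n w}) \<longlonglongrightarrow> 0"
    and "\<And>n. 1 \<le> n \<Longrightarrow> Measurable.pred Omega (Q n)"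
    and "\<And>n w. 1 \<le> n \<Longrightarrow> P n w \<Longrightarrow> Q n w"
  shows "(\<lambda>n. measure Omega {w. P n w}) \<longlonglongrightarrow> 0"
proof (rule tendsto_sandwich[OF _ _ tendsto_const assms(1)])
  show "\<forall>\<^sub>F n in sequentially. measure Omega {w. P n w} \<le> measure Omega {w. Q n w}"
    using eventually_ge_at_top[of "1::nat"]
  proof eventually_elim
    case (elim n)
    then show ?case
      using sets_pred[OF assms(2)[of n]] assms(3)[of n] by (intro Om.finite_measure_mono) auto
  qed
qed simp

lemma conv_lower_tail:
  assumes conv: "conv_unif_prob k f" and t: "0 \<le> t" and a: "a < f t"
  shows "(\<lambda>n. measure Omega {w. c1_frac k n t w < a}) \<longlonglongrightarrow> 0"
  by (rule measure_tendsto_0_mono[OF conv_prob[OF conv t, of "(f t - a) / 2"]])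
    (use a in \<open>auto simp: abs_if field_simps\<close>)

lemma conv_upper_tail:
  assumes conv: "conv_unif_prob k f" and t: "0 \<le> t" and a: "f t < a"
  shows "(\<lambda>n. measure Omega {w. a \<le> c1_frac k n t w}) \<longlonglongrightarrow> 0"
  by (rule measure_tendsto_0_mono[OF conv_prob[OF conv t, of "(a - f t) / 2"]])
    (use a in \<open>auto simp: abs_if field_simps\<close>)

lemma conv_expectation:
  assumes conv: "conv_unif_prob k f" and t: "0 \<le> t"
  shows "(\<lambda>n. EE (c1_frac k n t)) \<longlonglongrightarrow> f t"
proof (rule LIMSEQ_I)
  fix r :: real
  assume r: "0 < r"
  let ?P = "\<lambda>n w. r / 3 < \<bar>c1_frac k n t w - f t\<bar>"
  let ?K = "1 + \<bar>f t\<bar>"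
  have "(\<lambda>n. measure Omega {w. ?P n w}) \<longlonglongrightarrow> 0"
    using conv_prob[OF conv t, of "r / 3"] r by simp
  then obtain N where N: "\<And>n. N \<le> n \<Longrightarrow> measure Omega {w. ?P n w} < r / (3 * ?K)"
    using r LIMSEQ_D[of _ 0 "r / (3 * ?K)"] by fastforce
  have "norm (EE (c1_frac k n t) - f t) < r" if n: "max N 1 \<le> n" for n
  proof -
    have b: "bmeas (c1_frac k n t)" and b': "bmeas (\<lambda>w. of_bool (?P n w))"
      using bmeas_c1_frac n by auto
    have b'': "bmeas (\<lambda>w. r / 3 + ?K * of_bool (?P n w))"
      by (intro bmeas_add bmeas_mult bmeas_const b')
    have pt: "\<bar>c1_frac k n t w - f t\<bar> \<le> r / 3 + ?K * of_bool (?P n w)" for w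
      using c1_frac_bounds[of n k t w] n r by (cases "?P n w") auto
    have "EE (\<lambda>w. r / 3 + ?K * of_bool (?P n w)) = r / 3 + ?K * EE (\<lambda>w. of_bool (?P n w))"
      using b' by (subst EE_add) auto
    also have "EE (\<lambda>w. of_bool (?P n w)) = measure Omega {w. ?P n w}"
      by (rule EE_of_bool) measurable
    also have "r / 3 + ?K * measure Omega {w. ?P n w} \<le> r / 3 + ?K * (r / (3 * ?K))"
      using N[of n] n by (intro add_left_mono mult_left_mono) auto
    also have "\<dots> < r"
    proof -
      have "?K * (r / (3 * ?K)) = r / 3"
      proof -
        have "c * (r / (3 * c)) = r / 3" if "c \<noteq> 0" for c
          using that by simp
        moreover have "?K \<noteq> 0"
          using abs_ge_zero[of "f t"] by linarith
        ultimately show ?thesis .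
      qed
      then show ?thesis
        using r by simp
    qed
    finally have up: "EE (\<lambda>w. r / 3 + ?K * of_bool (?P n w)) < r" .
    have "EE (\<lambda>w. c1_frac k n t w - f t) \<le> EE (\<lambda>w. r / 3 + ?K * of_bool (?P n w))"
      by (intro EE_mono' bmeas_diff b b'' bmeas_const order_trans[OF abs_ge_self pt])
    moreover have "EE (\<lambda>w. f t - c1_frac k n t w) \<le> EE (\<lambda>w. r / 3 + ?K * of_bool (?P n w))"
      by (intro EE_mono' bmeas_diff b b'' bmeas_const)
        (rule order_trans[OF _ pt], simp add: abs_if)
    ultimately show ?thesis
      using up b by (simp add: EE_diff abs_if)
  qed
  then show "\<exists>N. \<forall>n\<ge>N. norm (EE (c1_frac k n t) - f t) < r"
    by blast
qed

lemma c1_frac_antimono_level: "1 \<le> n \<Longrightarrow> k \<le> k' \<Longrightarrow> c1_frac k' n t w \<le> c1_frac k n t w"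
  unfolding c1_frac_def G_rel_def
  by (intro divide_right_mono) (simp_all add: C1_mono level_rel_antimono)

lemma limit_antimono_level:
  assumes "conv_unif_prob k f" "conv_unif_prob k' f'" "k \<le> k'" "0 \<le> t"
  shows "f' t \<le> f t"
proof (rule LIMSEQ_le[OF conv_expectation[OF assms(2,4)] conv_expectation[OF assms(1,4)]])
  have "EE (c1_frac k' n t) \<le> EE (c1_frac k n t)" if "1 \<le> n" for n
    using that assms(3) by (intro EE_mono' bmeas_c1_frac c1_frac_antimono_level)
  then show "\<exists>N. \<forall>n\<ge>N. EE (c1_frac k' n t) \<le> EE (c1_frac k n t)"
    by blast
qed

section \<open>Subcritical graphs with additional edges\<close>

lemma pred_relpow:
  fixes R :: "'a \<Rightarrow> (nat \<times> nat) set"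
  assumes R: "\<And>a b. Measurable.pred M (\<lambda>w. (a, b) \<in> R w)"
  shows "Measurable.pred M (\<lambda>w. (a, b) \<in> R w ^^ k)"
proof (induction k arbitrary: b)
  case (Suc k)
  note [measurable] = R Suc
  have "Measurable.pred M (\<lambda>w. \<exists>c. (a, c) \<in> R w ^^ k \<and> (c, b) \<in> R w)"
    by measurable
  then show ?case
    by (simp add: relcomp_unfold)
qed simp

lemma pred_rtrancl:
  fixes R :: "'a \<Rightarrow> (nat \<times> nat) set"
  assumes R: "\<And>a b. Measurable.pred M (\<lambda>w. (a, b) \<in> R w)"
  shows "Measurable.pred M (\<lambda>w. (a, b) \<in> (R w)\<^sup>*)"
proof -
  note [measurable] = pred_relpow[OF R]
  have "Measurable.pred M (\<lambda>w. \<exists>k. (a, b) \<in> R w ^^ k)"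
    by measurable
  then show ?thesis
    by (simp add: rtrancl_power)
qed

definition key :: "nat \<Rightarrow> nat \<Rightarrow> edge" where
  "key u v = (min u v, max u v, 0)"

lemma key_sym: "key u v = key v u"
  by (simp add: key_def min.commute max.commute)

lemma key_eq: "key u v = key a b \<longleftrightarrow> {u, v} = {a, b}"
  by (auto simp: key_def min_def max_def doubleton_eq_iff split: if_splits)

definition window_rel :: "nat set \<Rightarrow> real set \<Rightarrow> sample \<Rightarrow> (nat \<times> nat) set" where
  "window_rel U S w = {(u, v). u \<in> U \<and> v \<in> U \<and> u \<noteq> v \<and> w (key u v) \<in> S}"

lemma sym_window_rel: "sym (window_rel U S w)"
  by (auto simp: sym_def window_rel_def key_sym)

lemma rtrancl_first_step:
  assumes "(x, y) \<in> (window_rel U S w)\<^sup>*" "x \<noteq> y"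
  shows "\<exists>u \<in> U - {x}. w (key x u) \<in> S \<and> (u, y) \<in> (window_rel (U - {x}) S w)\<^sup>*"
  using assms
proof (induction rule: rtrancl_induct)
  case (step y z)
  show ?case
  proof (cases "x = y")
    case True
    then show ?thesis
      using step.hyps by (intro bexI[of _ z]) (auto simp: window_rel_def)
  next
    case False
    then obtain u where u: "u \<in> U - {x}" "w (key x u) \<in> S" "(u, y) \<in> (window_rel (U - {x}) S w)\<^sup>*"
      using step.IH by auto
    have "(y, z) \<in> window_rel (U - {x}) S w"
      using step.hyps False step.prems by (auto simp: window_rel_def)
    then show ?thesis
      using u by (meson rtrancl.rtrancl_into_rtrancl)
  qed
qed simp

definition window_comp :: "nat set \<Rightarrow> real set \<Rightarrow> nat \<Rightarrow> sample \<Rightarrow> real" where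
  "window_comp U S x w = (\<Sum>y\<in>U. of_bool ((x, y) \<in> (window_rel U S w)\<^sup>*))"

lemma bmeas_window_comp:
  assumes S[measurable]: "S \<in> sets borel"
  shows "bmeas (window_comp U S x)"
proof -
  have "Measurable.pred Omega (\<lambda>w. (a, b) \<in> window_rel U S w)" for a b
    unfolding window_rel_def mem_Collect_eq case_prod_conv by measurable
  from pred_rtrancl[OF this] show ?thesis
    unfolding window_comp_def by (intro bmeas_sum bmeas_of_bool)
qed

text \<open>A component of a subcritical graph is explored by removing its root: the edges at the root are
  independent of the rest of the graph, so the bound \<open>1 / (1 - c)\<close> reproduces itself.\<close>
lemma subcritical_component:
  assumes S[measurable]: "S \<in> sets borel" and c: "0 \<le> c" "c < 1"
    and p: "\<And>i. EE (\<lambda>w. of_bool (w i \<in> S)) \<le> c / real n"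
    and U: "finite U" "card U \<le> n" "x \<in> U"
  shows "EE (window_comp U S x) \<le> 1 / (1 - c)"
  using U
proof (induction "card U" arbitrary: U x rule: less_induct)
  case less
  let ?V = "U - {x}"
  let ?g = "\<lambda>u w. of_bool (w (key x u) \<in> S) * window_comp ?V S u w"
  note b = bmeas_window_comp[OF S]
  have b': "bmeas (\<lambda>w. of_bool (w i \<in> S))" for i
    by (rule bmeas_of_bool) measurable
  have n: "0 < n"
    using less.prems by (auto simp: card_gt_0_iff intro: gr0I)
  have pt: "window_comp U S x w \<le> 1 + (\<Sum>u\<in>?V. ?g u w)" for w
  proof -
    have "of_bool ((x, y) \<in> (window_rel U S w)\<^sup>*) \<le> of_bool (y = x) +
        (\<Sum>u\<in>?V. of_bool (w (key x u) \<in> S) * (of_bool (y \<in> ?V \<and> (u, y) \<in> (window_rel ?V S w)\<^sup>*) :: real))"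
      (is "_ \<le> _ + (\<Sum>u\<in>_. ?t u)") if "y \<in> U" for y
    proof (cases "y \<noteq> x \<and> (x, y) \<in> (window_rel U S w)\<^sup>*")
      case True
      then obtain u where u: "u \<in> ?V" "w (key x u) \<in> S" "(u, y) \<in> (window_rel ?V S w)\<^sup>*"
        using rtrancl_first_step[of x y U S w] by auto
      have "?t u \<le> (\<Sum>u\<in>?V. ?t u)"
        using u less.prems by (intro member_le_sum) auto
      then show ?thesis
        using True u that by simp
    next
      case False
      then show ?thesis
        by (auto intro: sum_nonneg)
    qed
    then have "window_comp U S x w \<le> (\<Sum>y\<in>U. of_bool (y = x) +
        (\<Sum>u\<in>?V. of_bool (w (key x u) \<in> S) * of_bool (y \<in> ?V \<and> (u, y) \<in> (window_rel ?V S w)\<^sup>*)))"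
      unfolding window_comp_def by (intro sum_mono) auto
    also have "\<dots> = (\<Sum>y\<in>U. of_bool (y = x)) + (\<Sum>u\<in>?V. of_bool (w (key x u) \<in> S) *
        (\<Sum>y\<in>U. of_bool (y \<in> ?V \<and> (u, y) \<in> (window_rel ?V S w)\<^sup>*)))"
      unfolding sum.distrib sum_distrib_left by (subst (2) sum.swap) simp
    also have "(\<Sum>y\<in>U. of_bool (y = x)) = (1 :: real)"
      using less.prems by simp
    also have "(\<lambda>u. (\<Sum>y\<in>U. of_bool (y \<in> ?V \<and> (u, y) \<in> (window_rel ?V S w)\<^sup>*))) = (\<lambda>u. window_comp ?V S u w)"
      unfolding window_comp_def using less.prems by (intro ext sum.mono_neutral_cong_right) auto
    finally show ?thesis .
  qed
  have "EE (window_comp U S x) \<le> EE (\<lambda>w. 1 + (\<Sum>u\<in>?V. ?g u w))"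
    by (intro EE_mono' b pt bmeas_add bmeas_const bmeas_sum bmeas_mult b')
  also have "\<dots> = 1 + (\<Sum>u\<in>?V. EE (?g u))"
  proof -
    have "EE (\<lambda>w. 1 + (\<Sum>u\<in>?V. ?g u w)) = EE (\<lambda>w. 1) + EE (\<lambda>w. \<Sum>u\<in>?V. ?g u w)"
      by (intro EE_add bmeas_const bmeas_sum bmeas_mult b b')
    also have "EE (\<lambda>w. \<Sum>u\<in>?V. ?g u w) = (\<Sum>u\<in>?V. EE (?g u))"
      by (intro EE_sum bmeas_mult b b')
    finally show ?thesis
      by simp
  qed
  also have "(\<Sum>u\<in>?V. EE (?g u)) \<le> (\<Sum>u\<in>?V. c / real n * (1 / (1 - c)))"
  proof (rule sum_mono)
    fix u
    assume u: "u \<in> ?V"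
    have "EE (?g u) = EE (\<lambda>w. of_bool (w (key x u) \<in> S)) * EE (window_comp ?V S u)"
    proof (rule coord_indep[where B=1])
      have "window_rel ?V S (w(key x u := a)) = window_rel ?V S w" for w a
        by (auto simp: window_rel_def key_eq doubleton_eq_iff)
      then show "window_comp ?V S u (w(key x u := a)) = window_comp ?V S u w" for w a
        by (simp add: window_comp_def)
    qed (auto intro: b)
    also have "\<dots> \<le> c / real n * (1 / (1 - c))"
    proof (rule mult_mono[OF p])
      show "EE (window_comp ?V S u) \<le> 1 / (1 - c)"
        using less.prems u psubset_card_mono[of U ?V] card_Diff1_le[of U x]
        by (intro less.hyps) auto
      show "0 \<le> EE (window_comp ?V S u)"
        by (rule EE_nonneg) (auto simp: window_comp_def intro: sum_nonneg)
    qed (use c in auto)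
    finally show "EE (?g u) \<le> c / real n * (1 / (1 - c))" .
  qed
  also have "\<dots> = real (card ?V) / real n * (c / (1 - c))"
    by simp
  also have "\<dots> \<le> 1 * (c / (1 - c))"
    using less.prems c n card_Diff1_le[of U x] by (intro mult_right_mono) auto
  also have "1 + 1 * (c / (1 - c)) = 1 / (1 - c)"
    using c by (simp add: field_simps)
  finally show ?case by simp
qed

lemma reach_via_added_edges:
  assumes "(v, y) \<in> R\<^sup>*" "R \<subseteq> H \<union> F"
  shows "\<exists>x \<in> insert v (Range F). (x, y) \<in> H\<^sup>*"
  using assms(1)
proof (induction rule: rtrancl_induct)
  case (step y z)
  show ?case
  proof (cases "(y, z) \<in> F")
    case False
    then have "(y, z) \<in> H"
      using step.hyps assms(2) by auto
    then show ?thesis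
      using step.IH by (meson rtrancl.rtrancl_into_rtrancl)
  qed auto
qed auto

lemma C1_added_edges:
  assumes n: "1 \<le> n" and R: "R \<subseteq> H \<union> F" and H: "sym H" and B: "0 < B"
    and F: "F \<subseteq> {..<n} \<times> {..<n}"
  shows "real (C1 n R) \<le> B * (1 + real (card (Range F))) + (\<Sum>y<n. real (card (component n H y))) / B"
proof -
  have finF: "finite (Range F)"
    using F by (auto intro: finite_Range finite_subset)
  obtain v where v: "v < n" "card (component n R v) = C1 n R"
    using n C1_attained[of n R] by auto
  let ?V = "insert v (Range F)"
  let ?big = "{y. y < n \<and> B < real (card (component n H y))}"
  have V: "?V \<subseteq> {..<n}"
    using v F by auto
  have sub: "component n R v \<subseteq> (\<Union>x\<in>{x \<in> ?V. real (card (component n H x)) \<le> B}. component n H x) \<union> ?big"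
  proof
    fix y
    assume y: "y \<in> component n R v"
    then have "(v, y) \<in> R\<^sup>*"
      by (simp add: component_def)
    from reach_via_added_edges[OF this R] obtain x where x: "x \<in> ?V" "(x, y) \<in> H\<^sup>*" ..
    have "(y, x) \<in> H\<^sup>*"
      using x(2) sym_rtrancl[OF H] by (metis symD)
    then have "component n H x = component n H y"
      using x(2) by (auto simp: component_def intro: rtrancl_trans)
    then show "y \<in> (\<Union>x\<in>{x \<in> ?V. real (card (component n H x)) \<le> B}. component n H x) \<union> ?big"
      using x y by (cases "real (card (component n H x)) \<le> B") (auto simp: component_def)
  qed
  have "card (component n R v) \<le> card (\<Union>x\<in>{x \<in> ?V. real (card (component n H x)) \<le> B}. component n H x) + card ?big"
    using finF by (intro order_trans[OF card_mono[OF _ sub]] card_Un_le) auto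
  then have "real (C1 n R) \<le> real (card (\<Union>x\<in>{x \<in> ?V. real (card (component n H x)) \<le> B}. component n H x)) + real (card ?big)"
    using v by linarith
  also have "real (card (\<Union>x\<in>{x \<in> ?V. real (card (component n H x)) \<le> B}. component n H x))
      \<le> (\<Sum>x\<in>{x \<in> ?V. real (card (component n H x)) \<le> B}. real (card (component n H x)))"
    unfolding of_nat_sum[symmetric] of_nat_le_iff using finF by (intro card_UN_le) auto
  also have "\<dots> \<le> (\<Sum>x\<in>{x \<in> ?V. real (card (component n H x)) \<le> B}. B)"
    by (intro sum_mono) auto
  also have "\<dots> = B * real (card {x \<in> ?V. real (card (component n H x)) \<le> B})"
    by simp
  also have "\<dots> \<le> B * (1 + real (card (Range F)))"
  proof -
    have "card {x \<in> ?V. real (card (component n H x)) \<le> B} \<le> card ?V"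
      using finF by (intro card_mono) auto
    also have "\<dots> \<le> Suc (card (Range F))"
      using finF by (simp add: card_insert_if)
    finally show ?thesis
      using B by (intro mult_left_mono) auto
  qed
  also have "real (card ?big) \<le> (\<Sum>y<n. real (card (component n H y))) / B"
  proof -
    have "real (card ?big) = (\<Sum>y\<in>?big. 1)"
      by simp
    also have "\<dots> \<le> (\<Sum>y\<in>?big. real (card (component n H y)) / B)"
      using B by (intro sum_mono) auto
    also have "\<dots> \<le> (\<Sum>y<n. real (card (component n H y)) / B)"
      using B by (intro sum_mono2) auto
    finally show ?thesis
      by (simp add: sum_divide_distrib)
  qed
  finally show ?thesis by simp
qed

lemma window_comp_eq: "window_comp {..<n} S y w = real (card (component n (window_rel {..<n} S w) y))"
proof -
  have "window_comp {..<n} S y w = (\<Sum>u\<in>component n (window_rel {..<n} S w) y. 1)"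
    unfolding window_comp_def by (intro sum.mono_neutral_cong_right) (auto simp: component_def)
  then show ?thesis by simp
qed

definition second_arrival :: "real \<Rightarrow> nat \<Rightarrow> nat \<Rightarrow> sample \<Rightarrow> bool" where
  "second_arrival s u v w \<longleftrightarrow> w (u, v, 0) \<le> s \<and> w (u, v, 1) \<le> s"

lemma pred_second_arrival [measurable]: "Measurable.pred Omega (second_arrival s u v)"
  unfolding second_arrival_def by measurable

lemma prob_second_arrival:
  assumes "0 \<le> s"
  shows "EE (\<lambda>w. of_bool (second_arrival s u v w)) \<le> s\<^sup>2"
proof -
  have "EE (\<lambda>w. of_bool (second_arrival s u v w)) =
      EE (\<lambda>w. of_bool (w (u, v, 0) \<le> s) * of_bool (w (u, v, 1) \<le> s))"
    by (simp add: second_arrival_def of_bool_conj)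
  also have "\<dots> = EE (\<lambda>w. of_bool (w (u, v, 0) \<le> s)) * EE (\<lambda>w. of_bool (w (u, v, 1) \<le> s))"
    by (rule coord_indep[where B=1]) auto
  also have "\<dots> \<le> s * s"
    using assms by (intro mult_mono prob_le_bound EE_nonneg) auto
  finally show ?thesis
    by (simp add: power2_eq_square)
qed

lemma lab_arr_list_memD:
  assumes fin: "finite (edges_upto n w t)" and x: "(x, l) \<in> set (lab (arr_list n w t))"
  shows "x \<in> edges_upto n w t"
  using x fst_lab[of "arr_list n w t"] set_arr_list[OF fin] by force

lemma G_rel_cover:
  assumes w: "good w" and n: "1 \<le> n"
    and cover: "\<And>u v l. u < v \<Longrightarrow> v < n \<Longrightarrow> ((u, v, 0), l) \<in> set (lab (arr_list n w t)) \<Longrightarrow> k \<le> l \<Longrightarrow>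
       real n * w (u, v, 0) \<le> s \<Longrightarrow> E u v"
    and F: "F = {(u, v). u < v \<and> v < n \<and> (second_arrival (t / real n) u v w \<or> E u v)}"
  shows "G_rel n w t k \<subseteq> window_rel {..<n} {s / real n<..t / real n} w \<union> (F \<union> F\<inverse>)"
proof -
  have "ends x \<in> window_rel {..<n} {s / real n<..t / real n} w \<union> F"
    if xl: "(x, l) \<in> set (lab (arr_list n w t))" "k \<le> l" for x l
  proof -
    have "x \<in> edges_upto n w t"
      using lab_arr_list_memD[OF finite_edges_upto[OF w n] xl(1)] .
    moreover obtain u v j where x: "x = (u, v, j)"
      by (cases x)
    ultimately have uv: "u < v" "v < n" and arr: "arrival n w (u, v, j) \<le> t"
      by (auto simp: edges_upto_def)
    have le: "w (u, v, i) \<le> t / real n" if "i \<le> j" for i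
      using order_trans[OF arrival_ge_coord[OF w that] arr] n by (simp add: field_simps)
    show ?thesis
    proof (cases j)
      case 0
      then show ?thesis
        using cover[OF uv _ xl(2)] xl(1) le[of 0] n uv unfolding x F
        by (auto simp: window_rel_def key_def min_def max_def field_simps)
    next
      case (Suc i)
      then show ?thesis
        using le[of 0] le[of 1] uv unfolding x F by (auto simp: second_arrival_def)
    qed
  qed
  then show ?thesis
    using symD[OF sym_window_rel] unfolding G_rel_eq level_rel_def by fastforce
qed

lemma c1_frac_le_expectation:
  assumes n: "1 \<le> n" and t: "0 \<le> s" "s \<le> t" "t < s + 1" and B: "0 < B"
    and E[measurable]: "\<And>u v. Measurable.pred Omega (E u v)"
    and cover: "\<And>w u v l. good w \<Longrightarrow> u < v \<Longrightarrow> v < n \<Longrightarrow> ((u, v, 0), l) \<in> set (lab (arr_list n w t)) \<Longrightarrow>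
       k \<le> l \<Longrightarrow> real n * w (u, v, 0) \<le> s \<Longrightarrow> E u v w"
  shows "EE (c1_frac k n t) \<le> (B * (1 + 2 * t\<^sup>2) / real n +
      2 * B * ((\<Sum>u<n. \<Sum>v<n. EE (\<lambda>w. of_bool (u < v \<and> E u v w))) / real n)) + 1 / (1 - (t - s)) / B"
proof -
  let ?S = "{s / real n<..t / real n}"
  let ?D = "\<lambda>u v w. second_arrival (t / real n) u v w \<or> E u v w"
  let ?N1 = "\<lambda>w. \<Sum>u<n. \<Sum>v<n. of_bool (second_arrival (t / real n) u v w)"
  let ?N2 = "\<lambda>w. \<Sum>u<n. \<Sum>v<n. of_bool (u < v \<and> E u v w)"
  let ?X = "\<lambda>w. \<Sum>y<n. window_comp {..<n} ?S y w"
  have b1: "bmeas ?N1"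
    by (intro bmeas_sum bmeas_of_bool) measurable
  have b2: "bmeas ?N2"
    by (intro bmeas_sum bmeas_of_bool) measurable
  have b3: "bmeas ?X"
    by (intro bmeas_sum bmeas_window_comp) auto
  have pt: "c1_frac k n t w \<le> (B * (1 + 2 * (?N1 w + ?N2 w)) + ?X w / B) / real n" if w: "good w" for w
  proof -
    define F where "F = {(u, v). u < v \<and> v < n \<and> ?D u v w}"
    have finF: "finite F"
      by (rule finite_subset[of _ "{..<n} \<times> {..<n}"]) (auto simp: F_def)
    have "G_rel n w t k \<subseteq> window_rel {..<n} ?S w \<union> (F \<union> F\<inverse>)"
      by (rule G_rel_cover[OF w n cover[OF w]]) (auto simp: F_def)
    then have "real (C1 n (G_rel n w t k)) \<le> B * (1 + real (card (Range (F \<union> F\<inverse>)))) +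
        (\<Sum>y<n. real (card (component n (window_rel {..<n} ?S w) y))) / B"
      by (intro C1_added_edges n sym_window_rel B) (auto simp: F_def)
    moreover have "real (card (Range (F \<union> F\<inverse>))) \<le> 2 * (?N1 w + ?N2 w)"
    proof -
      have "Range (F \<union> F\<inverse>) = snd ` F \<union> fst ` F"
        by force
      then have "card (Range (F \<union> F\<inverse>)) \<le> card F + card F"
        by (simp add: order_trans[OF card_Un_le add_mono[OF card_image_le[OF finF] card_image_le[OF finF]]])
      then have a: "real (card (Range (F \<union> F\<inverse>))) \<le> real (card F) + real (card F)"
        by (metis of_nat_add of_nat_mono)
      have b: "real (card F) \<le> ?N1 w + ?N2 w"
      proof -
        have "real (card F) = (\<Sum>p\<in>F. 1)"
          by simp
        also have "\<dots> = (\<Sum>p\<in>{..<n} \<times> {..<n}. of_bool (p \<in> F))"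
          by (intro sum.mono_neutral_cong_left) (auto simp: F_def)
        also have "\<dots> = (\<Sum>u<n. \<Sum>v<n. of_bool ((u, v) \<in> F))"
          by (simp only: sum.cartesian_product split_def prod.collapse)
        also have "\<dots> \<le> (\<Sum>u<n. \<Sum>v<n. of_bool (second_arrival (t / real n) u v w) + of_bool (u < v \<and> E u v w))"
          by (intro sum_mono) (auto simp: F_def)
        finally show ?thesis
          by (simp add: sum.distrib)
      qed
      show ?thesis
        unfolding mult_2 by (rule order_trans[OF a add_mono[OF b b]])
    qed
    ultimately have "real (C1 n (G_rel n w t k)) \<le> B * (1 + 2 * (?N1 w + ?N2 w)) + ?X w / B"
      using B unfolding window_comp_eq by (smt (verit) mult_left_mono)
    then show ?thesis
      unfolding c1_frac_def by (intro divide_right_mono) auto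
  qed
  have "EE (c1_frac k n t) \<le> EE (\<lambda>w. (B * (1 + 2 * (?N1 w + ?N2 w)) + ?X w / B) / real n)"
    using AE_good pt by (intro EE_mono bmeas_c1_frac n bmeas_divide bmeas_add bmeas_mult bmeas_const b1 b2 b3) auto
  also have "\<dots> = (B * (1 + 2 * (EE ?N1 + EE ?N2)) + EE ?X / B) / real n"
  proof -
    note i = bmeas_integrable[OF b1] bmeas_integrable[OF b2] bmeas_integrable[OF b3]
    show ?thesis
      using i by simp
  qed
  also have "\<dots> \<le> (B * (1 + 2 * (t\<^sup>2 + EE ?N2)) + real n * (1 / (1 - (t - s))) / B) / real n"
  proof -
    have "EE ?N1 = (\<Sum>u<n. \<Sum>v<n. EE (\<lambda>w. of_bool (second_arrival (t / real n) u v w)))"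
      by (subst EE_sum, (intro bmeas_sum bmeas_of_bool, measurable)[1],
          subst EE_sum, (intro bmeas_of_bool, measurable)[1]) simp
    also have "\<dots> \<le> (\<Sum>u<n. \<Sum>v<n. (t / real n)\<^sup>2)"
      using t by (intro sum_mono prob_second_arrival) auto
    also have "\<dots> = t\<^sup>2"
      using n by (simp add: power2_eq_square)
    finally have "EE ?N1 \<le> t\<^sup>2" .
    moreover have "EE ?X \<le> real n * (1 / (1 - (t - s)))"
    proof -
      have p: "EE (\<lambda>w. of_bool (w i \<in> ?S)) \<le> (t - s) / real n" for i
      proof -
        have "EE (\<lambda>w. of_bool (w i \<in> ?S)) = exp (- (s / real n)) - exp (- (t / real n))"
          using prob_interval[of "s / real n" "t / real n" i] t n by (simp add: divide_right_mono)
        also have "\<dots> = exp (- (s / real n)) * (1 - exp (- ((t - s) / real n)))"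
          by (simp add: right_diff_distrib exp_add[symmetric] diff_divide_distrib)
        also have "\<dots> \<le> 1 * ((t - s) / real n)"
          using t exp_ge_add_one_self[of "- ((t - s) / real n)"] by (intro mult_mono) auto
        finally show ?thesis by simp
      qed
      have "EE ?X = (\<Sum>y<n. EE (window_comp {..<n} ?S y))"
        by (intro EE_sum bmeas_window_comp) auto
      also have "\<dots> \<le> (\<Sum>y<n. 1 / (1 - (t - s)))"
        using t by (intro sum_mono subcritical_component[where n=n] p) auto
      finally show ?thesis by simp
    qed
    ultimately show ?thesis
      using B by (intro divide_right_mono add_mono mult_left_mono) auto
  qed
  also have "EE ?N2 = (\<Sum>u<n. \<Sum>v<n. EE (\<lambda>w. of_bool (u < v \<and> E u v w)))"
    by (subst EE_sum, (intro bmeas_sum bmeas_of_bool, measurable)[1],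
          subst EE_sum, (intro bmeas_of_bool, measurable)[1]) simp
  also have "(B * (1 + 2 * (a + x)) + real n * q / B) / real n =
      (B * (1 + 2 * a) / real n + 2 * B * (x / real n)) + q / B" for a x q
    using n B by (simp add: field_simps)
  finally show ?thesis .
qed

lemma subcritical_limit:
  assumes t: "0 \<le> s" "s \<le> t" "t < s + 1"
    and E: "\<And>n u v. Measurable.pred Omega (E n u v)"
    and cover: "\<And>n w u v l. 1 \<le> n \<Longrightarrow> good w \<Longrightarrow> u < v \<Longrightarrow> v < n \<Longrightarrow>
       ((u, v, 0), l) \<in> set (lab (arr_list n w t)) \<Longrightarrow> k \<le> l \<Longrightarrow> real n * w (u, v, 0) \<le> s \<Longrightarrow> E n u v w"
    and small: "(\<lambda>n. (\<Sum>u<n. \<Sum>v<n. EE (\<lambda>w. of_bool (u < v \<and> E n u v w))) / real n) \<longlonglongrightarrow> 0"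
    and conv: "conv_unif_prob k f"
  shows "f t \<le> 0"
proof (rule field_le_epsilon)
  fix r :: real
  assume r: "0 < r"
  define B where "B = 1 / ((1 - (t - s)) * r)"
  have B: "0 < B"
    using r t by (simp add: B_def)
  have lim: "(\<lambda>n. (B * (1 + 2 * t\<^sup>2) / real n +
      2 * B * ((\<Sum>u<n. \<Sum>v<n. EE (\<lambda>w. of_bool (u < v \<and> E n u v w))) / real n)) + 1 / (1 - (t - s)) / B)
      \<longlonglongrightarrow> (0 + 2 * B * 0) + 1 / (1 - (t - s)) / B"
    by (intro tendsto_add tendsto_mult tendsto_const small lim_const_over_n)
  have "f t \<le> (0 + 2 * B * 0) + 1 / (1 - (t - s)) / B"
  proof (rule LIMSEQ_le[OF conv_expectation[OF conv] lim])
    show "0 \<le> t"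
      using t by simp
    show "\<exists>N. \<forall>n\<ge>N. EE (c1_frac k n t) \<le> (B * (1 + 2 * t\<^sup>2) / real n +
      2 * B * ((\<Sum>u<n. \<Sum>v<n. EE (\<lambda>w. of_bool (u < v \<and> E n u v w))) / real n)) + 1 / (1 - (t - s)) / B"
      using c1_frac_le_expectation[OF _ t B, where E="E n" and n=n and k=k for n] E cover
      by (intro exI[of _ 1]) blast
  qed
  also have "\<dots> = r"
    using t r by (simp add: B_def)
  finally show "f t \<le> 0 + r" by simp
qed

section \<open>The thresholds\<close>

lemma limit_below_one:
  assumes "conv_unif_prob 1 f" "0 \<le> t" "t < 1"
  shows "f t \<le> 0"
proof (rule subcritical_limit[where s=0 and E="\<lambda>_ _ _ _. False", OF _ _ _ _ _ _ assms(1)])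
  fix n w u v and l :: nat
  assume "1 \<le> n" "good w" "real n * w (u, v, 0) \<le> 0"
  then show False
    unfolding good_def by (metis mult_pos_pos not_le of_nat_0_less_iff less_le_trans zero_less_one)
qed (use assms in auto)

lemma distinct_arr_list: "distinct (arr_list n w t)"
proof -
  have "inj_on edge_decode (set (sorted_list_of_set (edge_code ` edges_upto n w t)))"
    by (cases "finite (edges_upto n w t)")
      (auto simp: inj_on_def finite_image_iff[OF inj_on_subset[OF inj_edge_code]])
  then show ?thesis
    by (simp add: arr_list_def distinct_map)
qed

lemma sorted_arr_list: "sorted (map (arrival n w) (arr_list n w t))"
  by (simp add: arr_list_def)

lemma arr_list_eq_filter:
  assumes "finite (edges_upto n w t)" "s \<le> t"
  shows "arr_list n w s = filter (\<lambda>x. arrival n w x \<le> s) (arr_list n w t)"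
  by (rule arr_list_filter[OF assms(1)]) (use assms in \<open>auto simp: edges_upto_def\<close>)

lemma arrival_later:
  assumes "good w" "1 \<le> n" "1 \<le> j"
  shows "arrival n w (u, v, 0) < arrival n w (u, v, j)"
proof -
  have pos: "0 < w x" for x
    using assms(1) unfolding good_def by blast
  have "(\<Sum>k\<in>{0, j}. w (u, v, k)) \<le> (\<Sum>k\<le>j. w (u, v, k))"
    using pos by (intro sum_mono2) (auto intro: less_imp_le)
  then have "w (u, v, 0) < (\<Sum>k\<le>j. w (u, v, k))"
    using pos[of "(u, v, j)"] assms(3) by simp
  then show ?thesis
    using assms(2) by (simp add: arrival_def)
qed

lemma connected_without_pair:
  assumes w: "good w" and n: "1 \<le> n" and s: "0 \<le> s" "s \<le> t"
    and uv: "u < v" "v < n" and mem: "((u, v, 0), l) \<in> set (lab (arr_list n w t))"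
    and k: "1 \<le> k" "Suc k \<le> l" and ws: "real n * w (u, v, 0) \<le> s"
  shows "(u, v) \<in> (G_rel n (wipe (\<lambda>p. p = (u, v)) (s + 1) w) s k)\<^sup>*"
proof -
  let ?x = "(u, v, 0 :: nat)"
  note fin = finite_edges_upto[OF w n]
  obtain P Q where M: "arr_list n w t = P @ ?x # Q" and l: "l = new_level (lab P) ?x"
    using lab_split[OF mem] by blast
  have "ends ?x \<in> (level_rel (lab P) k)\<^sup>*"
    using k l by (intro connected_below_level) auto
  then have conn: "(u, v) \<in> (level_rel (lab P) k)\<^sup>*"
    by simp
  have P: "arrival n w y \<le> s \<and> ends y \<noteq> (u, v)" if y: "y \<in> set P" for y
  proof
    have le: "arrival n w y \<le> arrival n w ?x"
      using sorted_arr_list[of n w t] y unfolding M by (auto simp: sorted_append)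
    then show "arrival n w y \<le> s"
      using ws by (simp add: arrival_0)
    show "ends y \<noteq> (u, v)"
    proof
      assume "ends y = (u, v)"
      then obtain j where j: "y = (u, v, j)"
        by (cases y) auto
      have "y \<noteq> ?x"
        using distinct_arr_list[of n w t] y unfolding M by auto
      then show False
        using arrival_later[OF w n, of j u v] le j by auto
    qed
  qed
  have "arr_list n (wipe (\<lambda>p. p = (u, v)) (s + 1) w) s =
      filter (\<lambda>x. ends x \<noteq> (u, v)) (filter (\<lambda>x. arrival n w x \<le> s) (arr_list n w t))"
    using arr_list_wipe[OF fin n s(1), where c="s + 1" and P="\<lambda>p. p = (u, v)"]
      arr_list_eq_filter[OF fin s(2)] by simp
  also have "\<dots> = P @ filter (\<lambda>x. ends x \<noteq> (u, v)) (filter (\<lambda>x. arrival n w x \<le> s) (?x # Q))"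
  proof -
    have "filter (\<lambda>x. ends x \<noteq> (u, v)) (filter (\<lambda>x. arrival n w x \<le> s) P) = P"
      unfolding filter_filter using P by (intro filter_True) auto
    then show ?thesis
      unfolding M filter_append by simp
  qed
  finally show ?thesis
    unfolding G_rel_eq using rtrancl_level_rel_append[OF conn] by simp
qed

lemma wipe_upd: "P (ends i) \<Longrightarrow> wipe P c (w(i := x)) = wipe P c w"
  unfolding wipe_def by (rule ext) (metis fun_upd_apply)

lemma pred_connected [measurable]: "Measurable.pred Omega (\<lambda>w. (u, v) \<in> (G_rel n w t k)\<^sup>*)"
  unfolding G_rel_eq by (rule pred_arr_list)

lemma pred_connected_wipe [measurable]:
  "Measurable.pred Omega (\<lambda>w. (u, v) \<in> (G_rel n (wipe P c w) t k)\<^sup>*)"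
  unfolding G_rel_eq by (rule pred_arr_list_wipe)

lemma arr_list_wipe_id:
  assumes w: "good w" and n: "1 \<le> n" and t: "0 \<le> t" "t < c"
    and late: "\<And>u v. P (u, v) \<Longrightarrow> u < v \<Longrightarrow> v < n \<Longrightarrow> t < real n * w (u, v, 0)"
  shows "arr_list n (wipe P c w) t = arr_list n w t"
proof -
  note fin = finite_edges_upto[OF w n]
  have "\<not> P (ends x)" if "x \<in> set (arr_list n w t)" for x
  proof
    assume P: "P (ends x)"
    obtain u v j where x: "x = (u, v, j)"
      by (cases x)
    have "u < v" "v < n" "arrival n w x \<le> t"
      using that unfolding set_arr_list[OF fin] edges_upto_def by (simp_all add: x)
    then show False
      using late[of u v] arrival_ge_coord[OF w, of 0 j n u v] P x by simp
  qed
  then show ?thesis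
    unfolding arr_list_wipe[OF fin n t] by simp
qed

lemma early_connected_prob:
  assumes n: "1 \<le> n" and s: "0 \<le> s"
  shows "EE (\<lambda>w. of_bool (real n * w (u, v, 0) \<le> s \<and>
      (u, v) \<in> (G_rel n (wipe (\<lambda>p. p = (u, v)) (s + 1) w) s k)\<^sup>*))
    \<le> s * exp s / real n * EE (\<lambda>w. of_bool ((u, v) \<in> (G_rel n w s k)\<^sup>*))"
proof -
  let ?g = "\<lambda>w. of_bool ((u, v) \<in> (G_rel n (wipe (\<lambda>p. p = (u, v)) (s + 1) w) s k)\<^sup>*) :: real"
  let ?p = "EE (\<lambda>w. of_bool ((u, v) \<in> (G_rel n w s k)\<^sup>*))"
  let ?a = "s / real n"
  have g: "bmeas ?g"
    by (rule bmeas_of_bool) measurable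
  have ind: "EE (\<lambda>w. h (w (u, v, 0)) * ?g w) = EE (\<lambda>w. h (w (u, v, 0))) * EE ?g"
    if "h \<in> borel_measurable borel" "\<And>x. \<bar>h x\<bar> \<le> 1" for h
    using that by (intro coord_indep g) (simp_all add: wipe_upd)
  have "exp (- ?a) * EE ?g = EE (\<lambda>w. of_bool (?a < w (u, v, 0))) * EE ?g"
    using prob_gt[of ?a "(u, v, 0)"] s by simp
  also have "\<dots> = EE (\<lambda>w. of_bool (?a < w (u, v, 0)) * ?g w)"
    by (rule ind[symmetric]) auto
  also have "\<dots> \<le> ?p"
  proof (rule EE_mono)
    show "AE w in Omega. of_bool (?a < w (u, v, 0)) * ?g w \<le> of_bool ((u, v) \<in> (G_rel n w s k)\<^sup>*)"
      using AE_good
    proof eventually_elim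
      case (elim w)
      have "arr_list n (wipe (\<lambda>p. p = (u, v)) (s + 1) w) s = arr_list n w s" if "?a < w (u, v, 0)"
        using that n s by (intro arr_list_wipe_id[OF elim n]) (auto simp: field_simps)
      then show ?case
        by (auto simp: G_rel_eq)
    qed
  qed (intro bmeas_mult g bmeas_of_bool; measurable)+
  finally have "EE ?g \<le> exp ?a * ?p"
    by (simp add: exp_minus field_simps)
  also have "\<dots> \<le> exp s * ?p"
  proof -
    have "?a \<le> s"
      using s n mult_left_mono[of 1 "real n" s] by (simp add: field_simps)
    then show ?thesis
      by (intro mult_right_mono EE_nonneg) auto
  qed
  finally have q: "EE ?g \<le> exp s * ?p" .
  have "EE (\<lambda>w. of_bool (real n * w (u, v, 0) \<le> s \<and>
      (u, v) \<in> (G_rel n (wipe (\<lambda>p. p = (u, v)) (s + 1) w) s k)\<^sup>*))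
    = EE (\<lambda>w. of_bool (w (u, v, 0) \<le> ?a) * ?g w)"
    using n by (intro Bochner_Integration.integral_cong) (auto simp: field_simps)
  also have "\<dots> = EE (\<lambda>w. of_bool (w (u, v, 0) \<le> ?a)) * EE ?g"
    by (rule ind) auto
  also have "\<dots> \<le> ?a * (exp s * ?p)"
    using s by (intro mult_mono prob_le_bound q EE_nonneg) auto
  finally show ?thesis
    by simp
qed

lemma limit_below_step:
  assumes k: "1 \<le> k" and conv: "conv_unif_prob k f" and conv': "conv_unif_prob (Suc k) f'"
    and s: "0 \<le> s" "f s = 0" and t: "s \<le> t" "t < s + 1"
  shows "f' t \<le> 0"
proof -
  define E where "E = (\<lambda>n u v w. real n * w (u, v, 0) \<le> s \<and>
      (u, v) \<in> (G_rel n (wipe (\<lambda>p. p = (u, v)) (s + 1) w) s k)\<^sup>*)"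
  have E: "Measurable.pred Omega (E n u v)" for n u v
    unfolding E_def by measurable
  let ?S = "\<lambda>n. (\<Sum>u<n. \<Sum>v<n. EE (\<lambda>w. of_bool (u < v \<and> E n u v w))) / real n"
  have bound: "?S n \<le> s * exp s * EE (c1_frac k n s)" if n: "1 \<le> n" for n
  proof -
    have b: "bmeas (\<lambda>w. of_bool ((u, v) \<in> (G_rel n w s k)\<^sup>*))" for u v
      by (rule bmeas_of_bool) measurable
    have "(\<Sum>u<n. \<Sum>v<n. EE (\<lambda>w. of_bool (u < v \<and> E n u v w)))
        \<le> (\<Sum>u<n. \<Sum>v<n. s * exp s / real n * EE (\<lambda>w. of_bool ((u, v) \<in> (G_rel n w s k)\<^sup>*)))"
    proof (intro sum_mono)
      fix u v
      have "EE (\<lambda>w. of_bool (u < v \<and> E n u v w)) \<le> EE (\<lambda>w. of_bool (E n u v w))"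
      proof (rule EE_mono')
        show "bmeas (\<lambda>w. of_bool (u < v \<and> E n u v w))" "bmeas (\<lambda>w. of_bool (E n u v w))"
          using E[of n u v] by (auto intro!: bmeas_of_bool)
      qed auto
      also have "\<dots> \<le> s * exp s / real n * EE (\<lambda>w. of_bool ((u, v) \<in> (G_rel n w s k)\<^sup>*))"
        unfolding E_def by (rule early_connected_prob[OF n s(1)])
      finally show "EE (\<lambda>w. of_bool (u < v \<and> E n u v w))
          \<le> s * exp s / real n * EE (\<lambda>w. of_bool ((u, v) \<in> (G_rel n w s k)\<^sup>*))" .
    qed
    also have "\<dots> = s * exp s / real n * (\<Sum>u<n. \<Sum>v<n. EE (\<lambda>w. of_bool ((u, v) \<in> (G_rel n w s k)\<^sup>*)))"
      by (simp only: sum_distrib_left)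
    finally have outer: "(\<Sum>u<n. \<Sum>v<n. EE (\<lambda>w. of_bool (u < v \<and> E n u v w)))
      \<le> s * exp s / real n * (\<Sum>u<n. \<Sum>v<n. EE (\<lambda>w. of_bool ((u, v) \<in> (G_rel n w s k)\<^sup>*)))" .
    have "(\<Sum>u<n. \<Sum>v<n. EE (\<lambda>w. of_bool ((u, v) \<in> (G_rel n w s k)\<^sup>*)))
        = EE (\<lambda>w. \<Sum>u<n. \<Sum>v<n. of_bool ((u, v) \<in> (G_rel n w s k)\<^sup>*))"
    proof -
      have "EE (\<lambda>w. \<Sum>u<n. \<Sum>v<n. of_bool ((u, v) \<in> (G_rel n w s k)\<^sup>*))
          = (\<Sum>u<n. EE (\<lambda>w. \<Sum>v<n. of_bool ((u, v) \<in> (G_rel n w s k)\<^sup>*)))"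
        by (intro EE_sum bmeas_sum b)
      also have "\<dots> = (\<Sum>u<n. \<Sum>v<n. EE (\<lambda>w. of_bool ((u, v) \<in> (G_rel n w s k)\<^sup>*)))"
        by (intro sum.cong refl EE_sum b)
      finally show ?thesis ..
    qed
    also have "\<dots> \<le> EE (\<lambda>w. real n * (real n * c1_frac k n s w))"
    proof (rule EE_mono')
      fix w
      have "(\<Sum>u<n. \<Sum>v<n. of_bool ((u, v) \<in> (G_rel n w s k)\<^sup>*)) =
          (\<Sum>u<n. real (card (component n (G_rel n w s k) u)))"
      proof (rule sum.cong[OF refl])
        fix u
        have "(\<Sum>v<n. of_bool ((u, v) \<in> (G_rel n w s k)\<^sup>*)) = (\<Sum>v\<in>component n (G_rel n w s k) u. 1 :: real)"
          by (intro sum.mono_neutral_cong_right) (auto simp: component_def)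
        then show "(\<Sum>v<n. of_bool ((u, v) \<in> (G_rel n w s k)\<^sup>*)) = real (card (component n (G_rel n w s k) u))"
          by simp
      qed
      also have "\<dots> \<le> (\<Sum>u<n. real (C1 n (G_rel n w s k)))"
        by (intro sum_mono) (simp add: card_component_le_C1)
      also have "\<dots> = real n * (real n * c1_frac k n s w)"
        using n by (simp add: c1_frac_def)
      finally show "(\<Sum>u<n. \<Sum>v<n. of_bool ((u, v) \<in> (G_rel n w s k)\<^sup>*)) \<le> real n * (real n * c1_frac k n s w)" .
    qed (intro bmeas_sum b bmeas_mult bmeas_const bmeas_c1_frac n)+
    also have "\<dots> = real n * (real n * EE (c1_frac k n s))"
      by simp
    finally have "s * exp s / real n * (\<Sum>u<n. \<Sum>v<n. EE (\<lambda>w. of_bool ((u, v) \<in> (G_rel n w s k)\<^sup>*)))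
        \<le> s * exp s / real n * (real n * (real n * EE (c1_frac k n s)))"
      using s(1) by (intro mult_left_mono) auto
    from order_trans[OF outer this] show ?thesis
      using n by (simp add: field_simps)
  qed
  show ?thesis
  proof (rule subcritical_limit[OF s(1) t E _ _ conv'])
    show "E n u v w" if "1 \<le> n" "good w" "u < v" "v < n" "((u, v, 0), l) \<in> set (lab (arr_list n w t))"
      "Suc k \<le> l" "real n * w (u, v, 0) \<le> s" for n w u v l
      unfolding E_def using connected_without_pair[OF that(2,1) s(1) t(1) that(3-5) k that(6,7)] that(7) by simp
    show "?S \<longlonglongrightarrow> 0"
    proof (rule tendsto_sandwich[OF _ _ tendsto_const])
      show "\<forall>\<^sub>F n in sequentially. 0 \<le> ?S n"
        by (intro always_eventually allI divide_nonneg_nonneg sum_nonneg EE_nonneg) auto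
      show "\<forall>\<^sub>F n in sequentially. ?S n \<le> s * exp s * EE (c1_frac k n s)"
        using bound by (auto simp: eventually_sequentially)
      show "(\<lambda>n. s * exp s * EE (c1_frac k n s)) \<longlonglongrightarrow> 0"
        using tendsto_mult_left[OF conv_expectation[OF conv s(1)], of "s * exp s"] s(2) by simp
    qed
  qed
qed

section \<open>Stars attached to a connected set\<close>

text \<open>The coordinate \<open>key u v\<close> is the scaled first arrival time on a pair, \<open>key2 u v\<close> the gap to the second.\<close>
definition key2 :: "nat \<Rightarrow> nat \<Rightarrow> edge" where
  "key2 u v = (min u v, max u v, 1)"

definition star :: "nat \<Rightarrow> real \<Rightarrow> real \<Rightarrow> nat \<Rightarrow> nat set \<Rightarrow> sample \<Rightarrow> bool" where
  "star n r t v S w \<longleftrightarrow> (\<forall>u \<in> {..<n} - {v}.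
     if u \<in> S then r < real n * w (key v u) \<and> real n * w (key v u) \<le> t \<and> t < real n * w (key2 v u)
     else t < real n * w (key v u))"

lemma pred_star [measurable]: "Measurable.pred Omega (star n r t v S)"
proof -
  have "Measurable.pred Omega (\<lambda>w. if u \<in> S then r < real n * w (key v u) \<and> real n * w (key v u) \<le> t \<and> t < real n * w (key2 v u)
     else t < real n * w (key v u))" for u
    by (cases "u \<in> S") simp_all
  then show ?thesis
    unfolding star_def by (intro pred_intros_finite) auto
qed

lemma inj_key: "inj_on (key v) (- {v})"
  by (auto simp: inj_on_def key_eq doubleton_eq_iff)

lemma star_prob:
  assumes n: "1 \<le> n" and r: "0 \<le> r" "r \<le> t" and S: "S \<subseteq> {..<n} - {v}" "card S \<le> n"
    and g: "bmeas g" "\<And>w. 0 \<le> g w" and ign: "ignores {i. fst (ends i) = v \<or> snd (ends i) = v} g"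
  shows "((t - r) / real n) ^ card S * exp (- 2 * t) * EE g \<le> EE (\<lambda>w. of_bool (star n r t v S w) * g w)"
proof -
  let ?V = "{..<n} - {v}"
  let ?I = "key v ` ?V \<union> key2 v ` S"
  let ?T = "\<lambda>i. if i \<in> key v ` S then {r / real n<..t / real n} else {t / real n<..}"
  have finS: "finite S"
    using S by (auto intro: finite_subset)
  have kk: "key v u \<noteq> key2 v' u'" for u v' u'
    by (auto simp: key_def key2_def)
  have kS: "key v u \<in> key v ` S \<longleftrightarrow> u \<in> S" if "u \<in> ?V" for u
  proof -
    have "inj_on (key v) (insert u S)"
      using that S by (intro inj_on_subset[OF inj_key]) auto
    then show ?thesis
      by (auto simp: inj_on_def)
  qed
  have prod: "of_bool (star n r t v S w) = (\<Prod>i\<in>?I. of_bool (w i \<in> ?T i) :: real)" for w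
  proof -
    have eq: "star n r t v S w \<longleftrightarrow> (\<forall>i\<in>?I. w i \<in> ?T i)"
    proof -
      have a1: "w (key v u) \<in> ?T (key v u) \<longleftrightarrow> (if u \<in> S then r < real n * w (key v u) \<and> real n * w (key v u) \<le> t
          else t < real n * w (key v u))" if "u \<in> ?V" for u
        using kS[OF that] n by (auto simp: field_simps)
      have a2: "w (key2 v u) \<in> ?T (key2 v u) \<longleftrightarrow> t < real n * w (key2 v u)" for u
      proof -
        have "key2 v u \<notin> key v ` S"
          using kk[symmetric] by auto
        then show ?thesis
          using n by (simp add: field_simps)
      qed
      have "(\<forall>i\<in>?I. w i \<in> ?T i) \<longleftrightarrow> (\<forall>u\<in>?V. w (key v u) \<in> ?T (key v u)) \<and> (\<forall>u\<in>S. w (key2 v u) \<in> ?T (key2 v u))"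
        by blast
      also have "\<dots> \<longleftrightarrow> (\<forall>u\<in>?V. if u \<in> S then r < real n * w (key v u) \<and> real n * w (key v u) \<le> t
          else t < real n * w (key v u)) \<and> (\<forall>u\<in>S. t < real n * w (key2 v u))"
        by (intro arg_cong2[where f="(\<and>)"] ball_cong a1 a2 refl)
      also have "\<dots> \<longleftrightarrow> star n r t v S w"
        using S(1) unfolding star_def by (auto split: if_splits)
      finally show ?thesis ..
    qed
    have fin: "finite ?I"
      using finS by simp
    show ?thesis
    proof (cases "star n r t v S w")
      case True
      then show ?thesis
        using eq by (auto simp: prod.neutral)
    next
      case False
      then obtain i where i: "i \<in> ?I" "w i \<notin> ?T i"
        using eq by blast
      have "(\<Prod>i\<in>?I. of_bool (w i \<in> ?T i) :: real) = 0"
        by (rule prod_zero[OF fin bexI[OF _ i(1)]]) (simp only: i(2) of_bool_eq)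
      then show ?thesis
        using False by simp
    qed
  qed
  have "?I \<subseteq> {i. fst (ends i) = v \<or> snd (ends i) = v}"
    by (auto simp: key_def key2_def min_def max_def split: if_splits)
  then have Ig: "ignores ?I g"
    using ign unfolding ignores_def by blast
  have "EE (\<lambda>w. of_bool (star n r t v S w) * g w) = (\<Prod>i\<in>?I. EE (\<lambda>w. of_bool (w i \<in> ?T i))) * EE g"
    unfolding prod using finS by (intro coords_indep[where B=1] g Ig) auto
  moreover have "((t - r) / real n) ^ card S * exp (- 2 * t) \<le> (\<Prod>i\<in>?I. EE (\<lambda>w. of_bool (w i \<in> ?T i)))"
  proof -
    let ?c = "\<lambda>i. exp (- (t / real n)) * (if i \<in> key v ` S then (t - r) / real n else 1)"
    have cI: "card ?I \<le> 2 * n"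
    proof -
      have "card ?I \<le> card (key v ` ?V) + card (key2 v ` S)"
        by (rule card_Un_le)
      also have "\<dots> \<le> card ?V + card S"
        by (intro add_mono card_image_le finS) auto
      also have "\<dots> \<le> n + n"
        using S(2) card_Diff1_le[of "{..<n}" v] by (intro add_mono) auto
      finally show ?thesis by simp
    qed
    have "((t - r) / real n) ^ card S * exp (- 2 * t) \<le> exp (- (t / real n)) ^ card ?I * ((t - r) / real n) ^ card S"
    proof -
      have "exp (- 2 * t) = exp (- (t / real n)) ^ (2 * n)"
        using n by (simp add: exp_of_nat_mult[symmetric])
      also have "\<dots> \<le> exp (- (t / real n)) ^ card ?I"
        using cI r n by (intro power_decreasing) auto
      finally have "exp (- 2 * t) * ((t - r) / real n) ^ card S \<le> exp (- (t / real n)) ^ card ?I * ((t - r) / real n) ^ card S"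
        using r by (intro mult_right_mono) auto
      then show ?thesis
        by (simp only: mult.commute)
    qed
    also have "\<dots> = (\<Prod>i\<in>?I. ?c i)"
    proof -
      have "(\<Prod>i\<in>?I. if i \<in> key v ` S then (t - r) / real n else 1) = (\<Prod>i\<in>key v ` S. (t - r) / real n)"
        using finS S(1) by (intro prod.mono_neutral_cong_right) auto
      also have "\<dots> = ((t - r) / real n) ^ card S"
      proof -
        have "inj_on (key v) S"
          using S(1) by (intro inj_on_subset[OF inj_key]) auto
        then show ?thesis
          by (simp add: card_image)
      qed
      finally show ?thesis
        by (simp add: prod.distrib)
    qed
    also have "\<dots> \<le> (\<Prod>i\<in>?I. EE (\<lambda>w. of_bool (w i \<in> ?T i)))"
    proof (rule prod_mono)
      fix i
      show "0 \<le> ?c i \<and> ?c i \<le> EE (\<lambda>w. of_bool (w i \<in> ?T i))"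
      proof (cases "i \<in> key v ` S")
        case True
        have "?c i = exp (- (t / real n)) * ((t - r) / real n)"
          using True by simp
        also have "\<dots> \<le> exp (- (t / real n)) * (exp ((t - r) / real n) - 1)"
          using exp_ge_add_one_self[of "(t - r) / real n"] by (intro mult_left_mono) (linarith, simp)
        also have "\<dots> = exp (- (r / real n)) - exp (- (t / real n))"
          by (simp add: right_diff_distrib exp_add[symmetric] diff_divide_distrib)
        also have "\<dots> = EE (\<lambda>w. of_bool (w i \<in> ?T i))"
          using True prob_interval[of "r / real n" "t / real n" i] r n by (simp add: divide_right_mono)
        finally show ?thesis
          using r True by simp
      next
        case False
        then show ?thesis
          using prob_gt[of "t / real n" i] r by simp
      qed
    qed
    finally show ?thesis .
  qed
  ultimately show ?thesis
    using g(2) EE_nonneg[of g] by (simp add: mult_right_mono)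
qed

lemma isolated_at_level:
  assumes "\<And>x l. (x, l) \<in> set L \<Longrightarrow> incident v x \<Longrightarrow> l < k" "(v, y) \<in> (level_rel L k)\<^sup>*"
  shows "y = v"
proof -
  have "v \<notin> Domain (level_rel L k)"
    using assms(1) by (fastforce simp: level_rel_def incident_def)
  then show ?thesis
    using assms(2) by (metis DomainI converse_rtranclE)
qed

lemma star_late:
  assumes w: "good w" and star: "star n r t v S w" and r: "r \<le> t"
    and x: "x \<in> edges_upto n w s" and inc: "incident v x" and s: "s \<le> t"
  shows "r < s" "\<exists>u \<in> S. u < n \<and> u \<noteq> v \<and> x = key v u"
proof -
  obtain a b i where abi: "x = (a, b, i)"
    by (cases x)
  have ab: "a < b" "b < n" and arr: "arrival n w (a, b, i) \<le> s"
    using x by (auto simp: edges_upto_def abi)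
  obtain u where u: "u < n" "u \<noteq> v" "(a, b) = (min v u, max v u)"
  proof (cases "a = v")
    case True
    then show ?thesis
      using that[of b] ab by simp
  next
    case False
    then show ?thesis
      using that[of a] ab inc by (auto simp: incident_def abi)
  qed
  have c: "real n * w (min v u, max v u, i') \<le> s" if "i' \<le> i" for i'
    using arrival_ge_coord[OF w that, of n a b] arr u by simp
  have first: "real n * w (key v u) \<le> s"
    using c[of 0] by (simp add: key_def)
  have uS: "u \<in> S"
  proof (rule ccontr)
    assume "u \<notin> S"
    then have "t < real n * w (key v u)"
      using star u(1,2) unfolding star_def by auto
    then show False
      using first s by simp
  qed
  have st: "r < real n * w (key v u)" "t < real n * w (key2 v u)"
    using star u uS unfolding star_def by auto
  then show "r < s"
    using first by simp
  have "i = 0"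
  proof (rule ccontr)
    assume "i \<noteq> 0"
    then have "real n * w (key2 v u) \<le> s"
      using c[of 1] by (simp add: key2_def)
    then show False
      using st s by simp
  qed
  then have "x = key v u"
    using u by (simp add: abi key_def)
  then show "\<exists>u \<in> S. u < n \<and> u \<noteq> v \<and> x = key v u"
    using uS u by blast
qed

lemma star_vertex_levels:
  assumes w: "good w" and n: "1 \<le> n" and r: "0 \<le> r" "r \<le> t" and star: "star n r t v S w"
    and S: "S \<subseteq> {..<n} - {v}" "S \<subseteq> W" "card S = j"
    and W: "\<And>a a'. a \<in> W \<Longrightarrow> a' \<in> W \<Longrightarrow> (a, a') \<in> (G_rel n w r j)\<^sup>*" and v: "v < n"
  shows "(v, y) \<in> (G_rel n w t (Suc j))\<^sup>* \<Longrightarrow> y = v"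
    and "1 \<le> j \<Longrightarrow> b \<in> W \<Longrightarrow> (v, b) \<in> (G_rel n w t j)\<^sup>*"
proof -
  let ?M = "arr_list n w r"
  let ?N = "filter (\<lambda>x. r < arrival n w x) (arr_list n w t)"
  note fin = finite_edges_upto[OF w n]
  have MN: "arr_list n w t = ?M @ ?N"
    by (rule arr_list_prefix[OF fin r(2)])
  have inc: "set (filter (incident v) ?N) = key v ` S"
  proof (intro equalityI subsetI)
    fix x
    assume "x \<in> set (filter (incident v) ?N)"
    then have "x \<in> edges_upto n w t" "incident v x"
      by (auto simp: set_arr_list[OF fin])
    then show "x \<in> key v ` S"
      using star_late(2)[OF w star r(2), of x t] by auto
  next
    fix x
    assume "x \<in> key v ` S"
    then obtain u where u: "u \<in> S" "x = key v u"
      by auto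
    then have u': "u < n" "u \<noteq> v"
      using S by auto
    have "r < real n * w (key v u)" "real n * w (key v u) \<le> t"
      using star u u' unfolding star_def by auto
    then show "x \<in> set (filter (incident v) ?N)"
      using u' u v by (auto simp: set_arr_list[OF fin] edges_upto_def key_def arrival_0 incident_def min_def max_def)
  qed
  have "length (filter (incident v) ?N) = card (key v ` S)"
    unfolding inc[symmetric] by (intro distinct_card[symmetric] distinct_filter distinct_arr_list)
  also have "\<dots> = j"
    using S by (subst card_image) (auto intro: inj_on_subset[OF inj_key])
  finally have len: "length (filter (incident v) ?N) = j" .
  have levels: "(\<forall>(x, l) \<in> set (lab (?M @ ?N)). incident v x \<longrightarrow> l \<le> length (filter (incident v) ?N)) \<and>
    (\<forall>i b. 1 \<le> i \<longrightarrow> i \<le> length (filter (incident v) ?N) \<longrightarrow> b \<in> W \<longrightarrow>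
       (v, b) \<in> (level_rel (lab (?M @ ?N)) i)\<^sup>*)"
  proof (rule star_levels)
    show "(a, a') \<in> (level_rel (lab ?M) j)\<^sup>*" if "a \<in> W" "a' \<in> W" for a a'
      using W[OF that] by (simp add: G_rel_eq)
    show "\<not> incident v x" if "x \<in> set ?M" for x
      using that star_late(1)[OF w star r(2), of x r] r by (auto simp: set_arr_list[OF fin])
    show "crossing {v} W x \<and> fst x \<noteq> fst (snd x)" if "x \<in> set ?N" "incident v x" for x
    proof -
      have "x \<in> key v ` S"
        using that inc by auto
      then obtain u where u: "u \<in> S" "x = key v u"
        by auto
      then have "u \<in> W" "u \<noteq> v"
        using S by auto
      then show ?thesis
        using u(2) by (cases "v \<le> u") (simp_all add: crossing_def key_def min_def max_def)
    qed
    show "length (filter (incident v) ?N) \<le> j"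
      using len by simp
  qed
  have G: "G_rel n w t k = level_rel (lab (?M @ ?N)) k" for k
    by (simp only: G_rel_eq MN[symmetric])
  show "(v, y) \<in> (G_rel n w t (Suc j))\<^sup>* \<Longrightarrow> y = v"
    unfolding G using levels len by (elim isolated_at_level[rotated]) auto
  show "(v, b) \<in> (G_rel n w t j)\<^sup>*" if "1 \<le> j" "b \<in> W"
    unfolding G using levels len that by auto
qed

lemma limit_less_one:
  assumes conv: "conv_unif_prob 1 f" and t: "0 \<le> t"
  shows "f t < 1"
proof -
  have bound: "EE (c1_frac 1 n t) \<le> 1 + 1 / real n - exp (- 2 * t)" if n: "1 \<le> n" for n
  proof -
    have b: "bmeas (\<lambda>w. \<Sum>v<n. of_bool (star n 0 t v {} w))"
      by (intro bmeas_sum bmeas_of_bool) measurable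
    have "EE (c1_frac 1 n t) \<le> EE (\<lambda>w. 1 + 1 / real n - (\<Sum>v<n. of_bool (star n 0 t v {} w)) / real n)"
    proof (rule EE_mono)
      show "AE w in Omega. c1_frac 1 n t w \<le> 1 + 1 / real n - (\<Sum>v<n. of_bool (star n 0 t v {} w)) / real n"
        using AE_good
      proof eventually_elim
        case (elim w)
        let ?I = "{v \<in> {..<n}. star n 0 t v {} w}"
        have iso: "y = v" if "v \<in> ?I" "(v, y) \<in> (G_rel n w t 1)\<^sup>*" for v y
          using star_vertex_levels(1)[OF elim n order_refl t, of v "{}" "{}" 0 y] that by auto
        obtain v where v: "v < n" "card (component n (G_rel n w t 1) v) = C1 n (G_rel n w t 1)"
          using n C1_attained[of n] by auto
        have "component n (G_rel n w t 1) v \<subseteq> insert v ({..<n} - ?I)"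
        proof
          fix y
          assume y: "y \<in> component n (G_rel n w t 1) v"
          then have "(y, v) \<in> (G_rel n w t 1)\<^sup>*"
            unfolding component_def G_rel_def by (auto intro: rtrancl_level_rel_sym)
          then show "y \<in> insert v ({..<n} - ?I)"
            using y iso[of y v] by (auto simp: component_def)
        qed
        then have "C1 n (G_rel n w t 1) \<le> card (insert v ({..<n} - ?I))"
          unfolding v(2)[symmetric] by (intro card_mono) auto
        also have "\<dots> \<le> Suc (card ({..<n} - ?I))"
          by (simp add: card_insert_if)
        finally have "real (C1 n (G_rel n w t 1)) \<le> 1 + real (card ({..<n} - ?I))"
          by simp
        also have "real (card ({..<n} - ?I)) = real n - real (card ?I)"
        proof -
          have "card ?I \<le> card {..<n}"
            by (intro card_mono) auto
          then show ?thesis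
            by (subst card_Diff_subset) (auto simp: of_nat_diff)
        qed
        also have "real (card ?I) = (\<Sum>v<n. of_bool (star n 0 t v {} w))"
          by (simp add: Collect_conj_eq lessThan_def)
        finally have "c1_frac 1 n t w \<le> (1 + (real n - (\<Sum>v<n. of_bool (star n 0 t v {} w)))) / real n"
          unfolding c1_frac_def by (rule divide_right_mono) simp
        then show ?case
          using n by (simp add: add_divide_distrib diff_divide_distrib)
      qed
    qed (intro bmeas_c1_frac n bmeas_diff bmeas_const bmeas_divide b)+
    also have "\<dots> = 1 + 1 / real n - EE (\<lambda>w. \<Sum>v<n. of_bool (star n 0 t v {} w)) / real n"
      using bmeas_integrable[OF b] by simp
    also have "EE (\<lambda>w. \<Sum>v<n. of_bool (star n 0 t v {} w)) = (\<Sum>v<n. EE (\<lambda>w. of_bool (star n 0 t v {} w)))"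
      by (intro EE_sum bmeas_of_bool) measurable
    also have "1 + 1 / real n - (\<Sum>v<n. EE (\<lambda>w. of_bool (star n 0 t v {} w))) / real n \<le> 1 + 1 / real n - (\<Sum>v<n. exp (- 2 * t)) / real n"
    proof (intro diff_left_mono divide_right_mono sum_mono)
      show "exp (- 2 * t) \<le> EE (\<lambda>w. of_bool (star n 0 t v {} w))" for v
        using star_prob[OF n order_refl t, of "{}" v "\<lambda>_. 1"] by (simp add: ignores_def)
    qed simp
    also have "\<dots> = 1 + 1 / real n - exp (- 2 * t)"
      using n by simp
    finally show ?thesis .
  qed
  have "f t \<le> 1 + 0 - exp (- 2 * t)"
  proof (rule LIMSEQ_le[OF conv_expectation[OF conv t]])
    show "(\<lambda>n. 1 + 1 / real n - exp (- 2 * t)) \<longlonglongrightarrow> 1 + 0 - exp (- 2 * t)"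
      by (intro tendsto_intros lim_const_over_n)
  qed (use bound in blast)
  then show ?thesis
    using exp_gt_zero[of "- 2 * t"] by linarith
qed


definition largest :: "nat \<Rightarrow> nat \<Rightarrow> edge list \<Rightarrow> nat set" where
  "largest n j M = component n (level_rel (lab M) j)
     (SOME v. v < n \<and> card (component n (level_rel (lab M) j) v) = C1 n (level_rel (lab M) j))"

lemma largest:
  assumes "1 \<le> n"
  shows "\<exists>v < n. largest n j M = component n (level_rel (lab M) j) v"
    and "card (largest n j M) = C1 n (level_rel (lab M) j)"
proof -
  have "\<exists>v. v < n \<and> card (component n (level_rel (lab M) j) v) = C1 n (level_rel (lab M) j)"
    using assms C1_attained[of n] by (metis zero_less_one less_le_trans)
  from someI_ex[OF this] show "\<exists>v < n. largest n j M = component n (level_rel (lab M) j) v"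
    "card (largest n j M) = C1 n (level_rel (lab M) j)"
    unfolding largest_def by auto
qed

lemma component_connected:
  assumes "a \<in> component n (level_rel L j) v" "b \<in> component n (level_rel L j) v"
  shows "(a, b) \<in> (level_rel L j)\<^sup>*"
  using assms rtrancl_level_rel_sym unfolding component_def by (metis (mono_tags, lifting) mem_Collect_eq rtrancl_trans)

definition good_vertex :: "nat \<Rightarrow> nat \<Rightarrow> real \<Rightarrow> real \<Rightarrow> nat \<Rightarrow> sample \<Rightarrow> bool" where
  "good_vertex n j r t v w \<longleftrightarrow> (\<exists>S \<in> {S. S \<subseteq> {..<n} - {v} \<and> card S = j}.
     S \<subseteq> largest n j (arr_list n w r) \<and> star n r t v S w)"

lemma pred_good_vertex [measurable]: "Measurable.pred Omega (good_vertex n j r t v)"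
proof -
  have "finite {S. S \<subseteq> {..<n} - {v} \<and> card S = j}"
    by (rule finite_subset[of _ "Pow ({..<n} - {v})"]) auto
  then show ?thesis
    unfolding good_vertex_def
    by (intro pred_intros_finite pred_intros_logic pred_arr_list pred_star)
qed

lemma star_unique:
  assumes "star n r t v S w" "S \<subseteq> {..<n} - {v}"
  shows "S = {u \<in> {..<n} - {v}. real n * w (key v u) \<le> t}"
  using assms unfolding star_def by (fastforce split: if_splits)

lemma good_vertex_prob:
  assumes r: "0 \<le> r" "r \<le> t" and j: "1 \<le> j" "j \<le> n" and a: "0 < a" "real j \<le> a * real n / 2" and v: "v < n"
  shows "((t - r) * a / (2 * real j)) ^ j * exp (- 2 * t) *
      (exp (- 2 * t) - measure Omega {w. c1_frac j n r w < a}) \<le> EE (\<lambda>w. of_bool (good_vertex n j r t v w))"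
proof -
  let ?V = "{..<n} - {v}"
  let ?SS = "{S. S \<subseteq> ?V \<and> card S = j}"
  let ?P = "\<lambda>p. fst p = v \<or> snd p = v"
  let ?W = "\<lambda>w. largest n j (arr_list n (wipe ?P (r + 1) w) r)"
  let ?big = "\<lambda>w. a * real n \<le> real (card (?W w))"
  have n: "1 \<le> n"
    using j by simp
  have finSS: "finite ?SS"
    by (rule finite_subset[of _ "Pow ?V"]) auto
  have same: "arr_list n (wipe ?P (r + 1) w) r = arr_list n w r" if w: "good w" and star: "star n r t v S w" for w S
  proof (rule arr_list_wipe_id[OF w n r(1)])
    fix u u'
    assume P: "?P (u, u')" and u: "u < u'" "u' < n"
    obtain z where z: "z < n" "z \<noteq> v" "(u, u', 0) = key v z"
      using P u that[of u] that[of u'] by (cases "u = v") (auto simp: key_def)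
    have "r < real n * w (key v z)"
      using star z r(2) unfolding star_def by (cases "z \<in> S") force+
    then show "r < real n * w (u, u', 0)"
      using z(3) by simp
  qed simp
  have m1: "Measurable.pred Omega (\<lambda>w. S \<subseteq> ?W w)" for S
    by (rule pred_arr_list_wipe)
  have m2: "Measurable.pred Omega ?big"
    by (rule pred_arr_list_wipe)
  have m3: "Measurable.pred Omega (\<lambda>w. c1_frac j n r w < a)"
    by measurable
  have b1: "bmeas (\<lambda>w. of_bool (star n r t v S w) * of_bool (S \<subseteq> ?W w))" for S
    by (intro bmeas_mult bmeas_of_bool m1 pred_star)
  have ign: "ignores {i. fst (ends i) = v \<or> snd (ends i) = v} (\<lambda>w. of_bool (S \<subseteq> ?W w) :: real)" for S
    unfolding ignores_def by (simp add: wipe_upd)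
  let ?p = "((t - r) / real n) ^ j * exp (- 2 * t)"
  let ?c = "(a * real n / 2 / real j) ^ j"
  have p: "0 \<le> ?p"
    using r by simp
  have "exp (- 2 * t) - measure Omega {w. c1_frac j n r w < a} =
      exp (- 2 * t) - EE (\<lambda>w. of_bool (c1_frac j n r w < a))"
    by (simp only: EE_of_bool[OF m3])
  also have "\<dots> \<le> EE (\<lambda>w. of_bool (star n r t v {} w)) - EE (\<lambda>w. of_bool (c1_frac j n r w < a))"
    using star_prob[OF n r, of "{}" v "\<lambda>_. 1"] by (simp add: ignores_def)
  also have "\<dots> = EE (\<lambda>w. of_bool (star n r t v {} w) - of_bool (c1_frac j n r w < a))"
    by (intro EE_diff[symmetric] bmeas_of_bool pred_star m3)
  also have "\<dots> \<le> EE (\<lambda>w. of_bool (?big w))"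
  proof (rule EE_mono)
    show "AE w in Omega. of_bool (star n r t v {} w) - of_bool (c1_frac j n r w < a) \<le> (of_bool (?big w) :: real)"
      using AE_good
    proof eventually_elim
      case (elim w)
      have "?big w" if s: "star n r t v {} w" and c: "\<not> c1_frac j n r w < a"
      proof -
        have "card (?W w) = C1 n (G_rel n w r j)"
          unfolding same[OF elim s] largest(2)[OF n] G_rel_eq ..
        then show ?thesis
          using c n by (simp add: c1_frac_def field_simps)
      qed
      then show ?case by auto
    qed
  qed (intro bmeas_diff bmeas_of_bool pred_star m2 m3)+
  finally have big: "exp (- 2 * t) - measure Omega {w. c1_frac j n r w < a} \<le> EE (\<lambda>w. of_bool (?big w))" .
  have "((t - r) * a / (2 * real j)) ^ j * exp (- 2 * t) * (exp (- 2 * t) - measure Omega {w. c1_frac j n r w < a})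
      = ?p * (?c * (exp (- 2 * t) - measure Omega {w. c1_frac j n r w < a}))"
  proof -
    have "((t - r) * a / (2 * real j)) ^ j = ((t - r) / real n * (a * real n / 2 / real j)) ^ j"
      using n j by (intro arg_cong[where f="\<lambda>x. x ^ j"]) (simp add: field_simps)
    then show ?thesis
      by (simp only: power_mult_distrib mult_ac)
  qed
  also have "\<dots> \<le> ?p * (?c * EE (\<lambda>w. of_bool (?big w)))"
    using p a by (intro mult_left_mono big) auto
  also have "?c * EE (\<lambda>w. of_bool (?big w)) = EE (\<lambda>w. ?c * of_bool (?big w))"
    by simp
  also have "?p * \<dots> \<le> ?p * EE (\<lambda>w. \<Sum>S\<in>?SS. of_bool (S \<subseteq> ?W w))"
  proof (intro mult_left_mono p EE_mono' bmeas_mult bmeas_const bmeas_sum bmeas_of_bool m1 m2)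
    fix w
    show "?c * of_bool (?big w) \<le> (\<Sum>S\<in>?SS. of_bool (S \<subseteq> ?W w))"
    proof (cases "?big w")
      case True
      let ?A = "?V \<inter> ?W w"
      obtain v' where "?W w = component n (level_rel (lab (arr_list n (wipe ?P (r + 1) w) r)) j) v'"
        using largest(1)[OF n] by blast
      then have W: "?W w \<subseteq> {..<n}" "finite (?W w)"
        by (auto simp: component_def)
      then have "?A = ?W w - {v}"
        by auto
      then have "real (card (?W w)) - 1 \<le> real (card ?A)"
        using W by (simp add: card_Diff_singleton_if) linarith
      moreover have "1 \<le> a * real n / 2"
        using j a by linarith
      ultimately have A: "a * real n / 2 \<le> real (card ?A)"
        using True by linarith
      then have jA: "j \<le> card ?A"
        using a by linarith
      have "?c \<le> (real (card ?A) / real j) ^ j"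
        using A a by (intro power_mono divide_right_mono) auto
      also have "\<dots> \<le> real (card ?A choose j)"
        using binomial_ge_n_over_k_pow_k[OF jA, where 'a=real] by simp
      also have "card ?A choose j = card {S. S \<subseteq> ?A \<and> card S = j}"
        using W by (intro n_subsets[symmetric]) auto
      also have "{S. S \<subseteq> ?A \<and> card S = j} = {S \<in> ?SS. S \<subseteq> ?W w}"
        by auto
      also have "real (card {S \<in> ?SS. S \<subseteq> ?W w}) = (\<Sum>S\<in>?SS. of_bool (S \<subseteq> ?W w))"
        using finSS by (simp add: Collect_conj_eq Int_assoc)
      finally show ?thesis
        using True by simp
    qed (auto intro: sum_nonneg)
  qed
  also have "\<dots> = (\<Sum>S\<in>?SS. ?p * EE (\<lambda>w. of_bool (S \<subseteq> ?W w)))"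
  proof -
    have "EE (\<lambda>w. \<Sum>S\<in>?SS. of_bool (S \<subseteq> ?W w)) = (\<Sum>S\<in>?SS. EE (\<lambda>w. of_bool (S \<subseteq> ?W w)))"
      by (intro EE_sum bmeas_of_bool m1)
    then show ?thesis
      by (simp only: sum_distrib_left)
  qed
  also have "\<dots> \<le> (\<Sum>S\<in>?SS. EE (\<lambda>w. of_bool (star n r t v S w) * of_bool (S \<subseteq> ?W w)))"
  proof (rule sum_mono)
    fix S
    assume S: "S \<in> ?SS"
    have "bmeas (\<lambda>w. of_bool (S \<subseteq> ?W w))"
      by (intro bmeas_of_bool m1)
    from star_prob[OF n r _ _ this _ ign[of S]]
    show "?p * EE (\<lambda>w. of_bool (S \<subseteq> ?W w)) \<le> EE (\<lambda>w. of_bool (star n r t v S w) * of_bool (S \<subseteq> ?W w))"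
      using S j(2) by auto
  qed
  also have "\<dots> = EE (\<lambda>w. \<Sum>S\<in>?SS. of_bool (star n r t v S w) * of_bool (S \<subseteq> ?W w))"
    by (intro EE_sum[symmetric] b1)
  also have "\<dots> \<le> EE (\<lambda>w. of_bool (good_vertex n j r t v w))"
  proof (rule EE_mono)
    show "AE w in Omega. (\<Sum>S\<in>?SS. of_bool (star n r t v S w) * of_bool (S \<subseteq> ?W w))
        \<le> (of_bool (good_vertex n j r t v w) :: real)"
      using AE_good
    proof eventually_elim
      case (elim w)
      let ?S0 = "{u \<in> ?V. real n * w (key v u) \<le> t}"
      have "(\<Sum>S\<in>?SS. of_bool (star n r t v S w) * of_bool (S \<subseteq> ?W w))
          \<le> (\<Sum>S\<in>?SS. if S = ?S0 then of_bool (good_vertex n j r t v w) else (0 :: real))"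
      proof (rule sum_mono)
        fix S
        assume S: "S \<in> ?SS"
        show "of_bool (star n r t v S w) * of_bool (S \<subseteq> ?W w)
            \<le> (if S = ?S0 then of_bool (good_vertex n j r t v w) else (0 :: real))"
        proof (cases "star n r t v S w \<and> S \<subseteq> ?W w")
          case True
          then have "S = ?S0"
            using star_unique[of n r t v S w] S by blast
          moreover have "good_vertex n j r t v w"
            unfolding good_vertex_def using True S same[OF elim, of S] by (intro bexI[of _ S]) auto
          ultimately show ?thesis
            by simp
        qed auto
      qed
      also have "\<dots> \<le> of_bool (good_vertex n j r t v w)"
        using finSS by (simp add: sum.delta)
      finally show ?case .
    qed
  qed (intro bmeas_sum b1 bmeas_of_bool pred_good_vertex)+
  finally show ?thesis .
qed

section \<open>Uniqueness of the giant component\<close>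

text \<open>Indicator of a first arrival in \<open>(t, t']\<close>, centred by its conditional probability given no arrival until \<open>t\<close>.\<close>
definition fresh :: "nat \<Rightarrow> real \<Rightarrow> real \<Rightarrow> real \<Rightarrow> real" where
  "fresh n t t' x = of_bool (t / real n < x) *
     (of_bool (x \<le> t' / real n) - (1 - exp (- ((t' - t) / real n))))"

lemma measurable_fresh [measurable]: "fresh n t t' \<in> borel_measurable borel"
  unfolding fresh_def by measurable

lemma abs_fresh_le:
  assumes "t \<le> t'"
  shows "\<bar>fresh n t t' x\<bar> \<le> 1"
proof -
  have "\<bar>of_bool P * (of_bool Q - (1 - e))\<bar> \<le> 1" if "0 < e" "e \<le> 1" for e :: real and P Q
    using that by (cases P; cases Q) (simp_all add: abs_if)
  then show ?thesis
    unfolding fresh_def using assms by simp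
qed

lemma bmeas_fresh: "t \<le> t' \<Longrightarrow> bmeas (\<lambda>w. fresh n t t' (w i))"
  by (rule bmeasI[OF _ abs_fresh_le]) measurable

lemma fresh_mean_zero:
  assumes "0 \<le> t" "t \<le> t'"
  shows "EE (\<lambda>w. fresh n t t' (w i)) = 0"
proof -
  let ?q = "1 - exp (- ((t' - t) / real n))"
  have le: "t / real n \<le> t' / real n"
    using assms by (simp add: divide_right_mono)
  have "EE (\<lambda>w. fresh n t t' (w i)) =
      EE (\<lambda>w. of_bool (t / real n < w i \<and> w i \<le> t' / real n) - ?q * of_bool (t / real n < w i))"
    by (intro Bochner_Integration.integral_cong) (auto simp: fresh_def)
  also have "\<dots> = EE (\<lambda>w. of_bool (t / real n < w i \<and> w i \<le> t' / real n)) - EE (\<lambda>w. ?q * of_bool (t / real n < w i))"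
    by (intro EE_diff bmeas_mult bmeas_const bmeas_of_bool) measurable
  also have "\<dots> = exp (- (t / real n)) - exp (- (t' / real n)) - ?q * exp (- (t / real n))"
    using prob_interval[OF _ le, of i] prob_gt[of "t / real n" i] assms by simp
  also have "\<dots> = 0"
    by (simp add: left_diff_distrib exp_add[symmetric] diff_divide_distrib)
  finally show ?thesis .
qed

lemma fresh_second_moment:
  assumes "0 \<le> t" "t \<le> t'"
  shows "EE (\<lambda>w. (fresh n t t' (w i))\<^sup>2) \<le> 2 * ((t' - t) / real n)"
proof -
  let ?q = "1 - exp (- ((t' - t) / real n))"
  have le: "t / real n \<le> t' / real n"
    using assms by (simp add: divide_right_mono)
  have q: "0 \<le> ?q" "?q \<le> (t' - t) / real n"
    using assms exp_ge_add_one_self[of "- ((t' - t) / real n)"] by auto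
  have "EE (\<lambda>w. (fresh n t t' (w i))\<^sup>2) \<le> EE (\<lambda>w. of_bool (t / real n < w i \<and> w i \<le> t' / real n) + ?q)"
  proof (rule EE_mono')
    fix w
    show "(fresh n t t' (w i))\<^sup>2 \<le> of_bool (t / real n < w i \<and> w i \<le> t' / real n) + ?q"
    proof (cases "t / real n < w i \<and> w i \<le> t' / real n")
      case True
      have "(fresh n t t' (w i))\<^sup>2 \<le> 1"
        using abs_fresh_le[OF assms(2), of n "w i"] by (simp add: abs_square_le_1)
      moreover have "(1 :: real) \<le> of_bool (t / real n < w i \<and> w i \<le> t' / real n) + ?q"
        using True q(1) by simp
      ultimately show ?thesis
        by (rule order_trans)
    next
      case False
      have "?q\<^sup>2 \<le> ?q"
        using q(1) by (simp add: power2_eq_square mult_left_le)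
      moreover have "(fresh n t t' (w i))\<^sup>2 = of_bool (t / real n < w i) * ?q\<^sup>2"
        using False by (auto simp: fresh_def power2_eq_square algebra_simps)
      moreover have "of_bool (t / real n < w i) * ?q\<^sup>2 \<le> 1 * ?q\<^sup>2"
        by (intro mult_right_mono) auto
      moreover have "of_bool (t / real n < w i \<and> w i \<le> t' / real n) = (0 :: real)"
        using False by simp
      ultimately show ?thesis
        by linarith
    qed
  qed (intro bmeas_power2 bmeas_fresh assms bmeas_add bmeas_const bmeas_of_bool; measurable)+
  also have "\<dots> = EE (\<lambda>w. of_bool (t / real n < w i \<and> w i \<le> t' / real n)) + EE (\<lambda>w. ?q)"
    by (intro EE_add bmeas_const bmeas_of_bool) measurable
  also have "\<dots> = exp (- (t / real n)) - exp (- (t' / real n)) + ?q"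
    using prob_interval[OF _ le, of i] assms by simp
  also have "exp (- (t / real n)) - exp (- (t' / real n)) = exp (- (t / real n)) * ?q"
    by (simp add: right_diff_distrib exp_add[symmetric] diff_divide_distrib)
  also have "exp (- (t / real n)) * ?q + ?q \<le> 1 * ?q + ?q"
    using q assms by (intro add_mono mult_right_mono) auto
  also have "\<dots> \<le> 2 * ((t' - t) / real n)"
    unfolding mult_1 mult_2 by (intro add_mono q(2))
  finally show ?thesis .
qed

text \<open>On the event that no edge has arrived on a pair, the past does not depend on the
  coordinates of that pair, so by the memoryless property future arrivals are uncorrelated.\<close>
lemma fresh_orthogonal:
  fixes F :: "edge list \<Rightarrow> real"
  assumes n: "1 \<le> n" and t: "0 \<le> t" "t \<le> t'" and p: "(u, v) \<noteq> (u', v')" and F: "\<And>M. \<bar>F M\<bar> \<le> 1"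
  shows "EE (\<lambda>w. fresh n t t' (w (u, v, 0)) * (fresh n t t' (w (u', v', 0)) * F (arr_list n w t))) = 0"
proof -
  let ?P = "\<lambda>p. p = (u, v)"
  let ?g = "\<lambda>w. fresh n t t' (w (u', v', 0)) * F (arr_list n (wipe ?P (t + 1) w) t)"
  have bF: "bmeas (\<lambda>w. F (arr_list n (wipe ?P (t + 1) w) t))"
    by (rule bmeasI[OF _ F]) measurable
  have bF': "bmeas (\<lambda>w. F (arr_list n w t))"
    by (rule bmeasI[OF _ F]) measurable
  have g: "bmeas ?g"
    by (intro bmeas_mult bmeas_fresh t bF)
  have "EE (\<lambda>w. fresh n t t' (w (u, v, 0)) * (fresh n t t' (w (u', v', 0)) * F (arr_list n w t)))
      = EE (\<lambda>w. fresh n t t' (w (u, v, 0)) * ?g w)"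
  proof (rule integral_cong_AE)
    show "AE w in Omega. fresh n t t' (w (u, v, 0)) * (fresh n t t' (w (u', v', 0)) * F (arr_list n w t))
        = fresh n t t' (w (u, v, 0)) * ?g w"
      using AE_good
    proof eventually_elim
      case (elim w)
      show ?case
      proof (cases "t / real n < w (u, v, 0)")
        case True
        then have "arr_list n (wipe ?P (t + 1) w) t = arr_list n w t"
          using n t by (intro arr_list_wipe_id[OF elim n]) (auto simp: field_simps)
        then show ?thesis by simp
      qed (simp add: fresh_def)
    qed
  qed (intro bmeasD bmeas_mult bmeas_fresh t bF bF')+
  also have "\<dots> = EE (\<lambda>w. fresh n t t' (w (u, v, 0))) * EE ?g"
    using p by (intro coord_indep[OF measurable_fresh abs_fresh_le[OF t(2)] g]) (auto simp: wipe_upd)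
  finally show ?thesis
    using fresh_mean_zero[OF t] by simp
qed

definition pairs :: "nat \<Rightarrow> (nat \<times> nat) set" where
  "pairs n = {(u, v). u < v \<and> v < n}"

lemma finite_pairs [simp]: "finite (pairs n)"
  by (rule finite_subset[of _ "{..<n} \<times> {..<n}"]) (auto simp: pairs_def)

lemma card_pairs_le: "card (pairs n) \<le> n * n"
proof -
  have "card (pairs n) \<le> card ({..<n} \<times> {..<n})"
    by (intro card_mono) (auto simp: pairs_def)
  then show ?thesis by simp
qed

definition coord :: "nat \<times> nat \<Rightarrow> edge" where
  "coord p = (fst p, snd p, 0)"

definition fluct :: "nat \<Rightarrow> real \<Rightarrow> real \<Rightarrow> (edge list \<Rightarrow> nat \<times> nat \<Rightarrow> real) \<Rightarrow> sample \<Rightarrow> real" where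
  "fluct n t t' c w = (\<Sum>p\<in>pairs n. fresh n t t' (w (coord p)) * c (arr_list n w t) p)"

lemma bmeas_fluct:
  assumes "t \<le> t'" and c: "\<And>M p. \<bar>c M p\<bar> \<le> 1"
  shows "bmeas (fluct n t t' c)"
proof -
  have "bmeas (\<lambda>w. c (arr_list n w t) p)" for p
    by (rule bmeasI[OF _ c]) measurable
  then show ?thesis
    unfolding fluct_def using assms by (intro bmeas_sum bmeas_mult bmeas_fresh)
qed

lemma fluct_second_moment:
  assumes n: "1 \<le> n" and t: "0 \<le> t" "t \<le> t'" and c: "\<And>M p. \<bar>c M p\<bar> \<le> 1"
  shows "EE (\<lambda>w. (fluct n t t' c w)\<^sup>2) \<le> 2 * (t' - t) * real n"
proof -
  let ?f = "\<lambda>p p' w. fresh n t t' (w (coord p)) * (fresh n t t' (w (coord p')) *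
     (c (arr_list n w t) p * c (arr_list n w t) p'))"
  have cc: "\<bar>c M p * c M p'\<bar> \<le> 1" for M p p'
    unfolding abs_mult using c[of M p] c[of M p'] by (intro mult_le_one) auto
  have b0: "bmeas (\<lambda>w. c (arr_list n w t) p * c (arr_list n w t) p')" for p p'
    by (rule bmeasI[OF _ cc]) measurable
  have b: "bmeas (?f p p')" for p p'
    by (intro bmeas_mult[OF bmeas_fresh bmeas_mult[OF bmeas_fresh b0]] t)
  have sq: "(fluct n t t' c w)\<^sup>2 = (\<Sum>p\<in>pairs n. \<Sum>p'\<in>pairs n. ?f p p' w)" for w
    unfolding fluct_def power2_eq_square sum_product by (intro sum.cong refl) simp
  have "EE (\<lambda>w. (fluct n t t' c w)\<^sup>2) = (\<Sum>p\<in>pairs n. EE (\<lambda>w. \<Sum>p'\<in>pairs n. ?f p p' w))"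
    unfolding sq by (intro EE_sum bmeas_sum b)
  also have "\<dots> = (\<Sum>p\<in>pairs n. \<Sum>p'\<in>pairs n. EE (?f p p'))"
    by (intro sum.cong refl EE_sum b)
  also have "\<dots> \<le> (\<Sum>p\<in>pairs n. \<Sum>p'\<in>pairs n. if p' = p then 2 * ((t' - t) / real n) else 0)"
  proof (intro sum_mono)
    fix p p'
    show "EE (?f p p') \<le> (if p' = p then 2 * ((t' - t) / real n) else 0)"
    proof (cases "p' = p")
      case True
      have "EE (?f p p') \<le> EE (\<lambda>w. (fresh n t t' (w (coord p)))\<^sup>2)"
      proof (rule EE_mono')
        fix w
        have "?f p p' w = (fresh n t t' (w (coord p)))\<^sup>2 * (c (arr_list n w t) p * c (arr_list n w t) p)"
          using True by (simp add: power2_eq_square)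
        also have "\<dots> \<le> (fresh n t t' (w (coord p)))\<^sup>2 * 1"
          using cc[of "arr_list n w t" p p] by (intro mult_left_mono) auto
        finally show "?f p p' w \<le> (fresh n t t' (w (coord p)))\<^sup>2" by simp
      qed (intro b bmeas_power2 bmeas_fresh t)+
      also have "\<dots> \<le> 2 * ((t' - t) / real n)"
        by (rule fresh_second_moment[OF t])
      finally show ?thesis
        using True by simp
    next
      case False
      then show ?thesis
        using fresh_orthogonal[OF n t, of "fst p" "snd p" "fst p'" "snd p'" "\<lambda>M. c M p * c M p'", OF _ cc]
        by (auto simp: coord_def prod_eq_iff)
    qed
  qed
  also have "\<dots> = real (card (pairs n)) * (2 * ((t' - t) / real n))"
    by (simp add: sum.delta)
  also have "\<dots> \<le> real (n * n) * (2 * ((t' - t) / real n))"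
    using card_pairs_le[of n] t by (intro mult_right_mono of_nat_mono) auto
  also have "\<dots> = 2 * (t' - t) * real n"
    using n by (simp add: field_simps)
  finally show ?thesis .
qed

definition two_big :: "nat \<Rightarrow> real \<Rightarrow> nat \<Rightarrow> edge list \<Rightarrow> nat \<times> nat \<Rightarrow> bool" where
  "two_big n m j M z \<longleftrightarrow> fst z < n \<and> snd z < n \<and> m \<le> real (card (component n (level_rel (lab M) j) (fst z))) \<and>
     m \<le> real (card (component n (level_rel (lab M) j) (snd z))) \<and> z \<notin> (level_rel (lab M) j)\<^sup>*"

text \<open>The chosen pair is arbitrary, but still a function of \<open>M\<close>, if no two big components exist.\<close>
definition joins :: "nat \<Rightarrow> real \<Rightarrow> nat \<Rightarrow> edge list \<Rightarrow> nat \<times> nat \<Rightarrow> bool" where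
  "joins n m j M p \<longleftrightarrow> (let z = SOME z. two_big n m j M z in
     crossing (component n (level_rel (lab M) j) (fst z)) (component n (level_rel (lab M) j) (snd z)) (coord p))"

lemma crossing_fluct_bound:
  assumes w: "good w" and n: "1 \<le> n" and t: "0 \<le> t" "t < t'" and j: "1 \<le> j" and m: "0 \<le> m"
    and two: "two_big n m j (arr_list n w t) z0"
    and C1: "real (C1 n (G_rel n w t' j)) < 2 * m"
  shows "(1 - exp (- ((t' - t) / real n))) * m\<^sup>2 \<le>
     (1 - exp (- ((t' - t) / real n))) * (\<Sum>p\<in>pairs n. of_bool (w (coord p) \<le> t / real n)) + real j
     - fluct n t t' (\<lambda>M p. of_bool (joins n m j M p)) w"
proof -
  let ?M = "arr_list n w t"
  let ?L = "lab ?M"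
  let ?q = "1 - exp (- ((t' - t) / real n))"
  define z where "z = (SOME z. two_big n m j ?M z)"
  define A where "A = component n (level_rel ?L j) (fst z)"
  define B where "B = component n (level_rel ?L j) (snd z)"
  let ?N = "filter (\<lambda>x. t < arrival n w x) (arr_list n w t')"
  have q: "0 \<le> ?q"
    using t by simp
  note fin = finite_edges_upto[OF w n]
  have z: "two_big n m j ?M z"
    unfolding z_def using two by (rule someI)
  have joins: "joins n m j ?M p \<longleftrightarrow> crossing A B (coord p)" for p
    unfolding joins_def A_def B_def z_def Let_def ..
  have AB: "A \<inter> B = {}"
  proof (rule ccontr)
    assume "A \<inter> B \<noteq> {}"
    then obtain y where "(fst z, y) \<in> (level_rel ?L j)\<^sup>*" "(snd z, y) \<in> (level_rel ?L j)\<^sup>*"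
      by (auto simp: A_def B_def component_def)
    then have "z \<in> (level_rel ?L j)\<^sup>*"
      using rtrancl_level_rel_sym[of "snd z" y] by (metis prod.collapse rtrancl_trans)
    then show False
      using z by (simp add: two_big_def)
  qed
  have fAB: "finite A" "finite B" "A \<subseteq> {..<n}" "B \<subseteq> {..<n}"
    by (auto simp: A_def B_def component_def)
  have mAB: "m \<le> real (card A)" "m \<le> real (card B)"
    using z by (auto simp: two_big_def A_def B_def)
  have zA: "fst z \<in> A" "snd z \<in> B"
    using z by (auto simp: two_big_def A_def B_def component_def)
  let ?new = "{p \<in> pairs n. crossing A B (coord p) \<and> t / real n < w (coord p) \<and> w (coord p) \<le> t' / real n}"
  have new: "card ?new < j"
  proof (rule ccontr)
    assume "\<not> card ?new < j"
    have "coord ` ?new \<subseteq> set (filter (crossing A B) ?N)"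
      using n by (auto simp: set_arr_list[OF fin] edges_upto_def pairs_def coord_def arrival_0 field_simps)
    then have "card (coord ` ?new) \<le> length (filter (crossing A B) ?N)"
      by (meson card_length card_mono finite_set order_trans)
    moreover have "card (coord ` ?new) = card ?new"
      by (intro card_image) (auto simp: inj_on_def coord_def)
    ultimately have len: "j \<le> length (filter (crossing A B) ?N)"
      using \<open>\<not> card ?new < j\<close> by simp
    have conn: "(a, b) \<in> (level_rel (lab (?M @ ?N)) j)\<^sup>*" if "a \<in> A" "b \<in> B" for a b
    proof (rule merge_by_crossing_edges[OF _ _ _ j order_refl len that])
      show "(a, a') \<in> (level_rel ?L j)\<^sup>*" if "a \<in> A" "a' \<in> A" for a a'
        using component_connected that unfolding A_def by blast
      show "(a, a') \<in> (level_rel ?L j)\<^sup>*" if "a \<in> B" "a' \<in> B" for a a'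
        using component_connected that unfolding B_def by blast
      show "fst x \<noteq> fst (snd x)" if "x \<in> set ?N" for x
        using that by (auto simp: set_arr_list[OF fin] edges_upto_def)
    qed
    have G: "G_rel n w t' j = level_rel (lab (?M @ ?N)) j"
      using arr_list_prefix[OF fin, of t t'] t by (simp add: G_rel_eq)
    have "A \<union> B \<subseteq> component n (G_rel n w t' j) (fst z)"
    proof
      fix y
      assume y: "y \<in> A \<union> B"
      show "y \<in> component n (G_rel n w t' j) (fst z)"
      proof (cases "y \<in> A")
        case True
        then have "(fst z, y) \<in> (level_rel (lab (?M @ ?N)) j)\<^sup>*"
          unfolding A_def component_def by (auto intro: rtrancl_level_rel_append)
        then show ?thesis
          using True fAB by (auto simp: component_def G)
      next
        case False
        then show ?thesis
          using y conn[OF zA(1), of y] fAB by (auto simp: component_def G)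
      qed
    qed
    then have "card A + card B \<le> card (component n (G_rel n w t' j) (fst z))"
      using fAB AB by (metis card_Un_disjoint card_mono finite_component)
    also have "\<dots> \<le> C1 n (G_rel n w t' j)"
      using z by (intro card_component_le_C1) (simp add: two_big_def)
    finally show False
      using mAB C1 by linarith
  qed
  let ?c = "\<lambda>p. of_bool (crossing A B (coord p)) :: real"
  have "m\<^sup>2 \<le> real (card A) * real (card B)"
    unfolding power2_eq_square using mAB m by (intro mult_mono) auto
  also have "\<dots> = real (card (A \<times> B))"
    by (simp add: card_cartesian_product)
  also have "\<dots> \<le> (\<Sum>p\<in>pairs n. ?c p)"
  proof -
    let ?h = "\<lambda>(a :: nat, b). (min a b, max a b)"
    have "inj_on ?h (A \<times> B)"
    proof (rule inj_onI, clarify)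
      fix a b a' b'
      assume "a \<in> A" "b \<in> B" "a' \<in> A" "b' \<in> B" "min a b = min a' b'" "max a b = max a' b'"
      then show "a = a' \<and> b = b'"
        using AB by (auto simp: min_def max_def split: if_splits)
    qed
    then have "card (A \<times> B) = card (?h ` (A \<times> B))"
      by (simp add: card_image)
    also have "\<dots> \<le> card {p \<in> pairs n. crossing A B (coord p)}"
    proof (rule card_mono)
      show "?h ` (A \<times> B) \<subseteq> {p \<in> pairs n. crossing A B (coord p)}"
      proof clarify
        fix a b
        assume ab: "a \<in> A" "b \<in> B"
        then have "a \<noteq> b" "a < n" "b < n"
          using AB fAB by auto
        then show "(min a b, max a b) \<in> pairs n \<and> crossing A B (coord (min a b, max a b))"
          using ab by (cases "a \<le> b") (auto simp: pairs_def crossing_def coord_def min_def max_def)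
      qed
    qed simp
    finally show ?thesis
      by (simp add: Collect_conj_eq)
  qed
  finally have A1: "m\<^sup>2 \<le> (\<Sum>p\<in>pairs n. ?c p)" .
  have "fluct n t t' (\<lambda>M p. of_bool (joins n m j M p)) w =
      (\<Sum>p\<in>pairs n. of_bool (p \<in> ?new) - ?q * (?c p * of_bool (t / real n < w (coord p))))"
    unfolding fluct_def joins by (intro sum.cong refl) (auto simp: fresh_def)
  also have "\<dots> = (\<Sum>p\<in>pairs n. of_bool (p \<in> ?new)) - ?q * (\<Sum>p\<in>pairs n. ?c p * of_bool (t / real n < w (coord p)))"
    by (simp only: sum_subtractf sum_distrib_left)
  also have "(\<Sum>p\<in>pairs n. of_bool (p \<in> ?new)) = real (card ?new)"
    by (simp add: Collect_conj_eq Int_assoc)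
  finally have A2: "fluct n t t' (\<lambda>M p. of_bool (joins n m j M p)) w =
    real (card ?new) - ?q * (\<Sum>p\<in>pairs n. ?c p * of_bool (t / real n < w (coord p)))" .
  have "(\<Sum>p\<in>pairs n. ?c p) \<le> (\<Sum>p\<in>pairs n. of_bool (w (coord p) \<le> t / real n) + ?c p * of_bool (t / real n < w (coord p)))"
    by (intro sum_mono) auto
  then have "m\<^sup>2 \<le> (\<Sum>p\<in>pairs n. of_bool (w (coord p) \<le> t / real n)) + (\<Sum>p\<in>pairs n. ?c p * of_bool (t / real n < w (coord p)))"
    using A1 by (simp add: sum.distrib)
  from mult_left_mono[OF this q] show ?thesis
    unfolding A2 distrib_left using new by linarith
qed


lemma two_big_prob:
  assumes n: "1 \<le> n" and t: "0 \<le> t" "t < t'" and j: "1 \<le> j" and a: "0 < a"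
  shows "measure Omega {w. \<exists>z. two_big n (a * real n) j (arr_list n w t) z} \<le>
     measure Omega {w. 2 * a \<le> c1_frac j n t' w} + t / a\<^sup>2 / real n +
     1 / ((t' - t) * a\<^sup>2) * (real j / real n + (2 * (t' - t) + 1) * sqrt (1 / real n)) * (1 + (t' - t) / real n)"
proof -
  let ?TB = "\<lambda>w. \<exists>z. two_big n (a * real n) j (arr_list n w t) z"
  let ?E = "\<lambda>w. 2 * a \<le> c1_frac j n t' w"
  let ?e = "t' - t"
  define q where "q = 1 - exp (- (?e / real n))"
  define s where "s = sqrt (real n)"
  define m where "m = a * real n"
  let ?Arr = "\<lambda>w. \<Sum>p\<in>pairs n. of_bool (w (coord p) \<le> t / real n)"
  let ?Y = "fluct n t t' (\<lambda>M p. of_bool (joins n m j M p))"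
  have e: "0 < ?e"
    using t by simp
  have s: "0 < s" "s * s = real n"
    using n by (auto simp: s_def)
  have q: "?e / (real n + ?e) \<le> q"
  proof -
    define x where "x = ?e / real n"
    have x: "0 < x"
      using e n by (simp add: x_def)
    have "exp (- x) \<le> 1 / (1 + x)"
      using exp_ge_add_one_self[of x] x by (simp add: exp_minus field_simps)
    then have "x / (1 + x) \<le> q"
      using x by (simp add: q_def x_def[symmetric] field_simps)
    moreover have "x / (1 + x) = ?e / (real n + ?e)"
    proof -
      have "y / real n / (1 + y / real n) = y / (real n + y)" if "0 < y" for y
        using that n by (simp add: field_simps)
      from this[OF e] show ?thesis
        by (simp only: x_def)
    qed
    ultimately show ?thesis by simp
  qed
  have q0: "0 < q"
    using e n q by (intro less_le_trans[OF _ q] divide_pos_pos) auto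
  have m0: "0 < m"
    using a n by (simp add: m_def)
  have mTB: "Measurable.pred Omega ?TB"
    by (rule pred_arr_list)
  have mE: "Measurable.pred Omega ?E"
    by measurable
  have bA: "bmeas ?Arr"
    by (intro bmeas_sum bmeas_of_bool) measurable
  have bY: "bmeas ?Y"
    using t by (intro bmeas_fluct) auto
  have "EE (\<lambda>w. of_bool (?TB w) * (q * m\<^sup>2)) \<le> EE (\<lambda>w. of_bool (?E w) * (q * m\<^sup>2) + (q * ?Arr w + (real j + ((?Y w)\<^sup>2 / s + s))))"
  proof (rule EE_mono)
    show "AE w in Omega. of_bool (?TB w) * (q * m\<^sup>2) \<le> of_bool (?E w) * (q * m\<^sup>2) + (q * ?Arr w + (real j + ((?Y w)\<^sup>2 / s + s)))"
      using AE_good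
    proof eventually_elim
      case (elim w)
      have nonneg: "0 \<le> q * ?Arr w + (real j + ((?Y w)\<^sup>2 / s + s))"
        using q0 s by (intro add_nonneg_nonneg mult_nonneg_nonneg sum_nonneg divide_nonneg_nonneg) auto
      show ?case
      proof (cases "?TB w \<and> \<not> ?E w")
        case True
        then obtain z where z: "two_big n m j (arr_list n w t) z"
          by (auto simp: m_def)
        have "real (C1 n (G_rel n w t' j)) < 2 * m"
          using True n by (simp add: c1_frac_def m_def field_simps)
        then have "q * m\<^sup>2 \<le> q * ?Arr w + real j - ?Y w"
          unfolding q_def using crossing_fluct_bound[OF elim n t j _ z] m0 by simp
        moreover have "- ?Y w \<le> (?Y w)\<^sup>2 / s + s"
        proof (cases "\<bar>?Y w\<bar> \<le> s")
          case True
          moreover have "0 \<le> (?Y w)\<^sup>2 / s"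
            using s by simp
          ultimately show ?thesis by linarith
        next
          case False
          then have "s * \<bar>?Y w\<bar> \<le> \<bar>?Y w\<bar> * \<bar>?Y w\<bar>"
            by (intro mult_right_mono) auto
          then have "\<bar>?Y w\<bar> \<le> (?Y w)\<^sup>2 / s"
            using s by (simp add: field_simps power2_eq_square)
          then show ?thesis
            using s by linarith
        qed
        ultimately show ?thesis
          using True by simp
      next
        case False
        then consider "\<not> ?TB w" | "?TB w" "?E w"
          by blast
        then show ?thesis
        proof cases
          case 1
          then have "of_bool (?TB w) * (q * m\<^sup>2) = 0"
            by simp
          moreover have "0 \<le> of_bool (?E w) * (q * m\<^sup>2)"
            using q0 by simp
          ultimately show ?thesis
            using nonneg by linarith
        next
          case 2
          then have "of_bool (?TB w) * (q * m\<^sup>2) = of_bool (?E w) * (q * m\<^sup>2)"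
            by (simp only: of_bool_eq)
          then show ?thesis
            using nonneg by linarith
        qed
      qed
    qed
  qed (intro bmeas_add bmeas_mult bmeas_divide bmeas_const bmeas_of_bool bmeas_power2 bA bY mTB mE)+
  also have "\<dots> = EE (\<lambda>w. of_bool (?E w)) * (q * m\<^sup>2) + (q * EE ?Arr + (real j + (EE (\<lambda>w. (?Y w)\<^sup>2) / s + s)))"
  proof -
    note i = bmeas_integrable[OF bmeas_of_bool[OF mE]] bmeas_integrable[OF bA] bmeas_integrable[OF bmeas_power2[OF bY]]
    show ?thesis
      using i by simp
  qed
  also have "\<dots> \<le> EE (\<lambda>w. of_bool (?E w)) * (q * m\<^sup>2) + (q * (t * real n) + (real j + (2 * ?e * real n / s + s)))"
  proof (intro add_mono order_refl mult_left_mono divide_right_mono)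
    have "EE ?Arr = (\<Sum>p\<in>pairs n. EE (\<lambda>w. of_bool (w (coord p) \<le> t / real n)))"
      by (intro EE_sum bmeas_of_bool) measurable
    also have "\<dots> \<le> (\<Sum>p\<in>pairs n. t / real n)"
      using t by (intro sum_mono prob_le_bound) auto
    also have "\<dots> = real (card (pairs n)) * (t / real n)"
      by simp
    also have "\<dots> \<le> real (n * n) * (t / real n)"
      using card_pairs_le[of n] t by (intro mult_right_mono of_nat_mono) auto
    also have "\<dots> = t * real n"
      using n by simp
    finally show "EE ?Arr \<le> t * real n" .
    show "EE (\<lambda>w. (?Y w)\<^sup>2) \<le> 2 * ?e * real n"
      using t by (intro fluct_second_moment n) auto
  qed (use q0 s in auto)
  also have "2 * ?e * real n / s = 2 * ?e * s"
    using s by (simp add: s(2)[symmetric])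
  finally have "EE (\<lambda>w. of_bool (?TB w)) * (q * m\<^sup>2) \<le>
      EE (\<lambda>w. of_bool (?E w)) * (q * m\<^sup>2) + (q * (t * real n) + (real j + (2 * ?e + 1) * s))"
    by (simp add: algebra_simps)
  then have "EE (\<lambda>w. of_bool (?TB w)) \<le>
      (EE (\<lambda>w. of_bool (?E w)) * (q * m\<^sup>2) + (q * (t * real n) + (real j + (2 * ?e + 1) * s))) / (q * m\<^sup>2)"
    using q0 m0 by (simp add: pos_le_divide_eq)
  also have "\<dots> = EE (\<lambda>w. of_bool (?E w)) + t * real n / m\<^sup>2 + (real j + (2 * ?e + 1) * s) / m\<^sup>2 * (1 / q)"
    using q0 m0 by (simp add: add_divide_distrib mult.commute)
  also have "\<dots> \<le> EE (\<lambda>w. of_bool (?E w)) + t * real n / m\<^sup>2 + (real j + (2 * ?e + 1) * s) / m\<^sup>2 * ((real n + ?e) / ?e)"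
  proof (intro add_left_mono mult_left_mono)
    have "1 / q \<le> 1 / (?e / (real n + ?e))"
      using q e n by (intro divide_left_mono mult_pos_pos q0 divide_pos_pos) auto
    then show "1 / q \<le> (real n + ?e) / ?e"
      by simp
  qed (use e s in auto)
  also have "t * real n / m\<^sup>2 = t / a\<^sup>2 / real n"
    using n by (simp add: m_def power2_eq_square)
  also have "(real j + (2 * ?e + 1) * s) / m\<^sup>2 * ((real n + ?e) / ?e) =
      1 / (?e * a\<^sup>2) * (real j / real n + (2 * ?e + 1) * (s / real n)) * (1 + ?e / real n)"
  proof -
    have "(real j + c * s) / m\<^sup>2 * ((real n + ?e) / ?e) =
      1 / (?e * a\<^sup>2) * ((real j + c * s) / real n) * ((real n + ?e) / real n)" for c
      using n by (simp add: m_def power2_eq_square)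
    then show ?thesis
      using n by (simp add: add_divide_distrib)
  qed
  also have "s / real n = sqrt (1 / real n)"
    using n by (simp add: s_def real_sqrt_divide field_simps)
  finally show ?thesis
    by (simp only: EE_of_bool[OF mTB] EE_of_bool[OF mE])
qed

lemma two_big_tendsto_0:
  assumes conv: "conv_unif_prob j f" and t: "0 \<le> t" "t < t'" and j: "1 \<le> j" and a: "0 < a" "f t' < 2 * a"
  shows "(\<lambda>n. measure Omega {w. \<exists>z. two_big n (a * real n) j (arr_list n w t) z}) \<longlonglongrightarrow> 0"
proof (rule tendsto_sandwich[OF _ _ tendsto_const])
  let ?U = "\<lambda>n. measure Omega {w. 2 * a \<le> c1_frac j n t' w} + t / a\<^sup>2 / real n +
     1 / ((t' - t) * a\<^sup>2) * (real j / real n + (2 * (t' - t) + 1) * sqrt (1 / real n)) * (1 + (t' - t) / real n)"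
  show "\<forall>\<^sub>F n in sequentially. measure Omega {w. \<exists>z. two_big n (a * real n) j (arr_list n w t) z} \<le> ?U n"
    using eventually_ge_at_top[of "1 :: nat"] by eventually_elim (rule two_big_prob[OF _ t j a(1)])
  have "?U \<longlonglongrightarrow> 0 + 0 + 1 / ((t' - t) * a\<^sup>2) * (0 + (2 * (t' - t) + 1) * sqrt 0) * (1 + 0)"
    using t a by (intro tendsto_add tendsto_mult tendsto_const lim_const_over_n tendsto_real_sqrt
        conv_upper_tail[OF conv]) auto
  then show "?U \<longlonglongrightarrow> 0"
    by simp
qed simp

section \<open>Strict monotonicity\<close>

lemma good_vertices_bound:
  assumes w: "good w" and n: "1 \<le> n" and r: "0 \<le> r" "r \<le> t" and j: "1 \<le> j" and a: "1 < a * real n"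
    and E1: "\<not> c1_frac j n r w < a" and E2: "\<not> c1_frac (Suc j) n t w < a"
    and TB: "\<nexists>z. two_big n (a * real n) j (arr_list n w t) z"
  shows "C1 n (G_rel n w t (Suc j)) + card {v \<in> {..<n}. good_vertex n j r t v w} \<le> C1 n (G_rel n w t j)"
proof -
  let ?R = "G_rel n w t j"
  let ?R' = "G_rel n w t (Suc j)"
  let ?I = "{v \<in> {..<n}. good_vertex n j r t v w}"
  note fin = finite_edges_upto[OF w n]
  define W where "W = largest n j (arr_list n w r)"
  obtain v0 where v0: "v0 < n" "W = component n (G_rel n w r j) v0"
    using largest(1)[OF n] unfolding W_def G_rel_eq by blast
  have "card W = C1 n (G_rel n w r j)"
    using largest(2)[OF n] by (simp add: W_def G_rel_eq)
  then have cardW: "a * real n \<le> real (card W)"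
    using E1 n by (simp add: c1_frac_def field_simps)
  obtain k0 where k0: "k0 < n" "card (component n ?R' k0) = C1 n ?R'"
    using n C1_attained[of n ?R'] by auto
  then have cardK: "a * real n \<le> real (card (component n ?R' k0))"
    using E2 n by (simp add: c1_frac_def field_simps)
  have sub1: "component n ?R' k0 \<subseteq> component n ?R k0"
    unfolding G_rel_def by (intro component_mono level_rel_antimono) simp
  have "G_rel n w r j \<subseteq> ?R"
    unfolding G_rel_eq using arr_list_prefix[OF fin r(2)]
    by (metis level_rel_set_mono set_lab_append)
  then have sub2: "W \<subseteq> component n ?R v0"
    unfolding v0(2) by (rule component_mono)
  have "a * real n \<le> real (card (component n ?R k0))" "a * real n \<le> real (card (component n ?R v0))"
    using cardK cardW card_mono[OF finite_component sub1] card_mono[OF finite_component sub2] by linarith+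
  then have kv: "(k0, v0) \<in> ?R\<^sup>*"
    using TB k0(1) v0(1) unfolding two_big_def G_rel_eq by (metis fst_conv snd_conv)
  have v0W: "v0 \<in> W"
    using v0 by (simp add: component_def)
  have I: "(v, v0) \<in> ?R\<^sup>*" "v \<notin> component n ?R' k0" if v: "v \<in> ?I" for v
  proof -
    obtain S where S: "S \<subseteq> {..<n} - {v}" "card S = j" "S \<subseteq> W" "star n r t v S w"
      using v unfolding good_vertex_def W_def by auto
    have conn: "(b, b') \<in> (G_rel n w r j)\<^sup>*" if "b \<in> W" "b' \<in> W" for b b'
      using that component_connected unfolding v0(2) G_rel_eq by blast
    have vn: "v < n"
      using v by simp
    note levels = star_vertex_levels[OF w n r S(4,1,3,2) conn vn]
    show "(v, v0) \<in> ?R\<^sup>*"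
      using levels(2)[OF _ _ j v0W] by blast
    show "v \<notin> component n ?R' k0"
    proof
      assume "v \<in> component n ?R' k0"
      then have "(v, k0) \<in> ?R'\<^sup>*"
        unfolding component_def G_rel_eq by (auto intro: rtrancl_level_rel_sym)
      then have "k0 = v"
        using levels(1) by blast
      then have "component n ?R' k0 \<subseteq> {v}"
        using levels(1) by (auto simp: component_def)
      then have "card (component n ?R' k0) \<le> card {v}"
        by (intro card_mono) auto
      then show False
        using cardK a by simp
    qed
  qed
  have "component n ?R' k0 \<union> ?I \<subseteq> component n ?R k0"
  proof -
    have "(k0, v) \<in> ?R\<^sup>*" if "v \<in> ?I" for v
      using kv I(1)[OF that] unfolding G_rel_eq by (meson rtrancl_level_rel_sym rtrancl_trans)
    then show ?thesis
      using sub1 by (auto simp: component_def)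
  qed
  then have "card (component n ?R' k0 \<union> ?I) \<le> card (component n ?R k0)"
    by (intro card_mono) auto
  moreover have "card (component n ?R' k0 \<union> ?I) = card (component n ?R' k0) + card ?I"
    using I(2) by (intro card_Un_disjoint) auto
  ultimately show ?thesis
    using k0(2) card_component_le_C1[OF k0(1), of ?R] by linarith
qed

lemma limit_strict_aux:
  assumes j: "1 \<le> j" and conv: "conv_unif_prob j f" and conv': "conv_unif_prob (Suc j) f'"
    and t: "0 \<le> r" "r < t" "t < t'" and a: "0 < a" "a < f r" "a < f' t" "f t' < 2 * a"
  shows "f' t < f t"
proof -
  let ?c = "((t - r) * a / (2 * real j)) ^ j * exp (- 2 * t)"
  let ?E1 = "\<lambda>n w. c1_frac j n r w < a"
  let ?E2 = "\<lambda>n w. c1_frac (Suc j) n t w < a"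
  let ?TB = "\<lambda>n w. \<exists>z. two_big n (a * real n) j (arr_list n w t) z"
  let ?P = "\<lambda>E. measure Omega {w. E w}"
  have bound: "?c * (exp (- 2 * t) - ?P (?E1 n)) \<le>
      EE (c1_frac j n t) - EE (c1_frac (Suc j) n t) + (?P (?E1 n) + (?P (?E2 n) + ?P (?TB n)))"
    if n: "1 \<le> n" "j \<le> n" "2 * real j \<le> a * real n" for n
  proof -
    have m1: "Measurable.pred Omega (?E1 n)"
      by measurable
    have m2: "Measurable.pred Omega (?E2 n)"
      by measurable
    have m3: "Measurable.pred Omega (?TB n)"
      by (rule pred_arr_list)
    note m = m1 m2 m3
    have b: "bmeas (\<lambda>w. \<Sum>v<n. of_bool (good_vertex n j r t v w))"
      by (intro bmeas_sum bmeas_of_bool pred_good_vertex)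
    have bE: "bmeas (\<lambda>w. of_bool (?E1 n w) + (of_bool (?E2 n w) + of_bool (?TB n w)))"
      by (intro bmeas_add bmeas_of_bool m)
    have bd: "bmeas (\<lambda>w. c1_frac j n t w - c1_frac (Suc j) n t w)"
      by (intro bmeas_diff bmeas_c1_frac n)
    have "?c * (exp (- 2 * t) - ?P (?E1 n)) = (\<Sum>v<n. ?c * (exp (- 2 * t) - ?P (?E1 n))) / real n"
      using n by simp
    also have "\<dots> \<le> (\<Sum>v<n. EE (\<lambda>w. of_bool (good_vertex n j r t v w))) / real n"
      using t j n a(1) by (intro divide_right_mono sum_mono good_vertex_prob) auto
    also have "(\<Sum>v<n. EE (\<lambda>w. of_bool (good_vertex n j r t v w))) =
        EE (\<lambda>w. \<Sum>v<n. of_bool (good_vertex n j r t v w))"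
      by (intro EE_sum[symmetric] bmeas_of_bool pred_good_vertex)
    also have "\<dots> / real n = EE (\<lambda>w. (\<Sum>v<n. of_bool (good_vertex n j r t v w)) / real n)"
      by simp
    also have "\<dots> \<le> EE (\<lambda>w. (c1_frac j n t w - c1_frac (Suc j) n t w) +
        (of_bool (?E1 n w) + (of_bool (?E2 n w) + of_bool (?TB n w))))"
    proof (rule EE_mono)
      show "AE w in Omega. (\<Sum>v<n. of_bool (good_vertex n j r t v w)) / real n \<le>
          (c1_frac j n t w - c1_frac (Suc j) n t w) + (of_bool (?E1 n w) + (of_bool (?E2 n w) + of_bool (?TB n w)))"
        using AE_good
      proof eventually_elim
        case (elim w)
        let ?I = "{v \<in> {..<n}. good_vertex n j r t v w}"
        have sum: "(\<Sum>v<n. of_bool (good_vertex n j r t v w)) = real (card ?I)"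
          by (simp add: Collect_conj_eq lessThan_def)
        have dec: "c1_frac (Suc j) n t w \<le> c1_frac j n t w"
          by (rule c1_frac_antimono_level[OF n(1)]) simp
        show ?case
        proof (cases "?E1 n w \<or> ?E2 n w \<or> ?TB n w")
          case True
          have "card ?I \<le> card {..<n}"
            by (intro card_mono) auto
          then have "real (card ?I) / real n \<le> 1"
            using n by simp
          also have "1 \<le> of_bool (?E1 n w) + (of_bool (?E2 n w) + (of_bool (?TB n w) :: real))"
            using True by (auto simp: of_bool_def)
          finally show ?thesis
            using dec unfolding sum by linarith
        next
          case False
          then have "C1 n (G_rel n w t (Suc j)) + card ?I \<le> C1 n (G_rel n w t j)"
            using n t j by (intro good_vertices_bound[where a=a] elim) auto
          then have "real (card ?I) \<le> real (C1 n (G_rel n w t j)) - real (C1 n (G_rel n w t (Suc j)))"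
            by linarith
          then have "real (card ?I) / real n \<le> c1_frac j n t w - c1_frac (Suc j) n t w"
            unfolding c1_frac_def diff_divide_distrib[symmetric] by (rule divide_right_mono) simp
          moreover have "0 \<le> of_bool (?E1 n w) + (of_bool (?E2 n w) + (of_bool (?TB n w) :: real))"
            by (intro add_nonneg_nonneg) auto
          ultimately show ?thesis
            unfolding sum by linarith
        qed
      qed
    qed (intro bmeas_divide b bmeas_add[OF bd bE])+
    also have "\<dots> = EE (\<lambda>w. c1_frac j n t w - c1_frac (Suc j) n t w) +
        EE (\<lambda>w. of_bool (?E1 n w) + (of_bool (?E2 n w) + of_bool (?TB n w)))"
      by (rule EE_add[OF bd bE])
    also have "EE (\<lambda>w. c1_frac j n t w - c1_frac (Suc j) n t w) = EE (c1_frac j n t) - EE (c1_frac (Suc j) n t)"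
      by (intro EE_diff bmeas_c1_frac n)
    also have "EE (\<lambda>w. of_bool (?E1 n w) + (of_bool (?E2 n w) + of_bool (?TB n w))) =
        ?P (?E1 n) + (?P (?E2 n) + ?P (?TB n))"
      using m by (simp only: EE_add EE_of_bool bmeas_of_bool bmeas_add)
    finally show ?thesis .
  qed
  have "?c * (exp (- 2 * t) - 0) \<le> f t - f' t + (0 + (0 + 0))"
  proof (rule LIMSEQ_le)
    have t0: "0 \<le> t"
      using t by simp
    show "(\<lambda>n. ?c * (exp (- 2 * t) - ?P (?E1 n))) \<longlonglongrightarrow> ?c * (exp (- 2 * t) - 0)"
      by (intro tendsto_mult tendsto_const tendsto_diff conv_lower_tail[OF conv t(1) a(2)])
    show "(\<lambda>n. EE (c1_frac j n t) - EE (c1_frac (Suc j) n t) + (?P (?E1 n) + (?P (?E2 n) + ?P (?TB n))))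
        \<longlonglongrightarrow> f t - f' t + (0 + (0 + 0))"
      by (intro tendsto_add tendsto_diff conv_expectation conv conv' t0 conv_lower_tail[OF conv t(1) a(2)]
          conv_lower_tail[OF conv' t0 a(3)] two_big_tendsto_0[OF conv t0 t(3) j a(1,4)])
    show "\<exists>N. \<forall>n\<ge>N. ?c * (exp (- 2 * t) - ?P (?E1 n)) \<le>
        EE (c1_frac j n t) - EE (c1_frac (Suc j) n t) + (?P (?E1 n) + (?P (?E2 n) + ?P (?TB n)))"
    proof (intro exI allI impI bound)
      fix n
      assume N: "max (max 1 j) (nat \<lceil>2 * real j / a\<rceil>) \<le> n"
      then show "1 \<le> n" "j \<le> n"
        by auto
      have "2 * real j / a \<le> real n"
        using N by linarith
      then show "2 * real j \<le> a * real n"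
        using a by (simp add: field_simps)
    qed
  qed
  moreover have "0 < ?c * (exp (- 2 * t) - 0)"
    using t a j by simp
  ultimately show ?thesis
    by linarith
qed

lemma limit_strict:
  assumes j: "1 \<le> j" and conv: "conv_unif_prob j f" and conv': "conv_unif_prob (Suc j) f'"
    and cont: "continuous_on {0..} f" and f0: "f 0 = 0" and t: "0 \<le> t" "0 < f t"
  shows "f' t < f t"
proof (rule ccontr)
  assume "\<not> f' t < f t"
  then have eq: "f' t = f t"
    using limit_antimono_level[OF conv conv' _ t(1)] by simp
  have "t \<noteq> 0"
    using f0 t by auto
  then have t0: "0 < t"
    using t by simp
  obtain d where d: "0 < d" "\<And>s. 0 \<le> s \<Longrightarrow> dist s t < d \<Longrightarrow> dist (f s) (f t) < f t / 4"
    using cont t unfolding continuous_on_iff by (metis atLeast_iff divide_pos_pos zero_less_numeral)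
  define r where "r = max 0 (t - d / 2)"
  have "dist (f r) (f t) < f t / 4"
    by (rule d(2)) (use d(1) t0 in \<open>auto simp: r_def dist_real_def\<close>)
  moreover have "dist (f (t + d / 2)) (f t) < f t / 4"
    by (rule d(2)) (use d(1) t0 in \<open>auto simp: dist_real_def\<close>)
  ultimately have "3 / 4 * f t < f r" "f (t + d / 2) < 2 * (3 / 4 * f t)"
    unfolding dist_real_def by linarith+
  then have "f' t < f t"
    using d(1) t0 t eq
    by (intro limit_strict_aux[OF j conv conv', of r t "t + d / 2" "3 / 4 * f t"]) (auto simp: r_def)
  then show False
    using eq by simp
qed

theorem theorem2p3:
  fixes \<rho> :: "nat \<Rightarrow> real \<Rightarrow> real" and \<sigma> :: "nat \<Rightarrow> real"
  assumes rho0: "\<And>t. \<rho> 0 t = 1"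
    and sigma0: "\<sigma> 0 = 0"
    and rho_conv: "\<And>k. 1 \<le> k \<Longrightarrow> conv_unif_prob k (\<rho> k)"
    and rho_cont: "\<And>k. 1 \<le> k \<Longrightarrow> continuous_on {0..} (\<rho> k)"
    and rho_mono: "\<And>k. 1 \<le> k \<Longrightarrow> mono_on {0..} (\<rho> k)"
    and rho_range: "\<And>k t. 1 \<le> k \<Longrightarrow> 0 \<le> t \<Longrightarrow> 0 \<le> \<rho> k t \<and> \<rho> k t \<le> 1"
    and sigma_pos: "\<And>k. 1 \<le> k \<Longrightarrow> 0 < \<sigma> k"
    and sigma_zero: "\<And>k t. 1 \<le> k \<Longrightarrow> 0 \<le> t \<Longrightarrow> t \<le> \<sigma> k \<Longrightarrow> \<rho> k t = 0"
    and sigma_posr: "\<And>k t. 1 \<le> k \<Longrightarrow> \<sigma> k < t \<Longrightarrow> 0 < \<rho> k t"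
  shows "\<forall>k\<ge>1. (\<forall>t\<ge>0. \<rho> k t \<le> \<rho> (k - 1) t \<and> (0 < \<rho> (k - 1) t \<longrightarrow> \<rho> k t < \<rho> (k - 1) t))
               \<and> \<sigma> (k - 1) + 1 \<le> \<sigma> k"
proof (intro allI impI)
  fix k :: nat
  assume "1 \<le> k"
  then obtain j where k: "k = Suc j"
    by (cases k) auto
  have threshold: "\<sigma> j + 1 \<le> \<sigma> k"
    if "0 \<le> \<sigma> j" and zero: "\<And>t. \<sigma> j \<le> t \<Longrightarrow> t < \<sigma> j + 1 \<Longrightarrow> \<rho> k t \<le> 0"
  proof (rule ccontr)
    assume less: "\<not> \<sigma> j + 1 \<le> \<sigma> k"
    define t where "t = (max (\<sigma> j) (\<sigma> k) + (\<sigma> j + 1)) / 2"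
    have "\<sigma> j \<le> t" "t < \<sigma> j + 1" "\<sigma> k < t"
      using less by (auto simp: t_def field_simps)
    then show False
      using zero[of t] sigma_posr[of k t] \<open>1 \<le> k\<close> by simp
  qed
  show "(\<forall>t\<ge>0. \<rho> k t \<le> \<rho> (k - 1) t \<and> (0 < \<rho> (k - 1) t \<longrightarrow> \<rho> k t < \<rho> (k - 1) t))
      \<and> \<sigma> (k - 1) + 1 \<le> \<sigma> k"
  proof (cases "j = 0")
    case True
    have conv: "conv_unif_prob 1 (\<rho> k)"
      using rho_conv[of k] by (simp add: k True)
    have "\<rho> k t < 1" if "0 \<le> t" for t
      using limit_less_one[OF conv that] .
    moreover have "\<sigma> j + 1 \<le> \<sigma> k"
      using limit_below_one[OF conv] by (intro threshold) (auto simp: True sigma0)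
    ultimately show ?thesis
      by (auto simp: k True rho0 less_imp_le)
  next
    case False
    then have j: "1 \<le> j"
      by simp
    have conv: "conv_unif_prob j (\<rho> j)" "conv_unif_prob (Suc j) (\<rho> k)"
      using rho_conv[of j] rho_conv[of k] j by (auto simp: k)
    have s: "0 \<le> \<sigma> j"
      using sigma_pos[OF j] by simp
    have "\<rho> k t \<le> \<rho> j t" if "0 \<le> t" for t
      using limit_antimono_level[OF conv _ that] by simp
    moreover have "\<rho> k t < \<rho> j t" if "0 \<le> t" "0 < \<rho> j t" for t
      using limit_strict[OF j conv rho_cont[OF j] _ that] sigma_zero[OF j _ s] by simp
    moreover have "\<sigma> j + 1 \<le> \<sigma> k"
      using limit_below_step[OF j conv s] sigma_zero[OF j s] s by (intro threshold) auto
    ultimately show ?thesis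
      by (simp add: k)
  qed
qed

end
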